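(* For $n\ge 9$ let $L_n:=\sum_{T\in\mathcal{T}(C_n^4)}|\mathcal{L}(T)|$ be the total number of leaves over all spanning trees of the fourth power $C_n^4$ of the cycle on $n$ vertices. Then there is a polynomial $A_4$ in $t$ of degree $80$ such that, as formal power series, $$\sum_{m=0}^{\infty} L_{m+9}\,t^m=\frac{A_4}{B_4},$$ where \begin{align*} B_4=\;&(t + 1)^3(t^6 - 3t^5 + 6t^4 - 10t^3 + 6t^2 - 3t + 1)^3\\ &(t^8 - 4t^7 - 17t^6 + 8t^5 + 49t^4 + 8t^3 - 17t^2 - 4t + 1)^3\\ &(t^{12} + 3t^{11} + 12t^{10} + 28t^9 - 27t^8 + 36t^7 - 81t^6 + 36t^5 - 27t^4 + 28t^3 + 12t^2 + 3t + 1)^3 . \end{align*}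
   Context: All graphs are finite and simple. $C_n$ is the cycle graph on $n$ vertices. For a graph $G$ and $k\ge1$, the $k$-th power $G^k$ has $V(G^k)=V(G)$, and $uv$ is an edge iff the distance between $u$ and $v$ in $G$ is at least $1$ and at most $k$. $\mathcal{T}(G)$ is the set of labeled spanning trees of $G$ (subgraphs that are trees on all of $V(G)$; isomorphic trees with different labels are different). $\mathcal{L}(T)$ is the set of leaves (vertices of degree exactly $1$ in $T$) of $T$. The family is $\mathcal{C}_k=\{C_n^k : n\ge 2k+1\}$, here with $k=4$; the sequence is indexed so that the constant term of the generating function corresponds to the smallest member $n=2k+1$. *)

theory Defs
  imports
    "HOL-Computational_Algebra.Polynomial_FPS"
    "HOL-Library.Extended_Nat"
begin

section \<open>Finite simple undirected graphs\<close>

text \<open>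
  A graph is a pair of a vertex set and a set of two-element edges. The digraph library from the
  AFP is not used here: it encodes an undirected edge as two opposite arcs, which its notion of
  cycle (and hence of forest, tree and spanning tree) already counts as a cycle.
\<close>

type_synonym 'a ugraph = "'a set \<times> 'a set set"

abbreviation ug_verts :: "'a ugraph \<Rightarrow> 'a set" where
  "ug_verts G \<equiv> fst G"

abbreviation ug_edges :: "'a ugraph \<Rightarrow> 'a set set" where
  "ug_edges G \<equiv> snd G"

definition ug_simple :: "'a ugraph \<Rightarrow> bool" where
  "ug_simple G \<longleftrightarrow>
     finite (ug_verts G) \<and> (\<forall>e \<in> ug_edges G. e \<subseteq> ug_verts G \<and> card e = 2)"

text \<open>A walk is the list of its vertices; its length as a walk is one less than that of the list.\<close>

definition ug_walk :: "'a ugraph \<Rightarrow> 'a \<Rightarrow> 'a list \<Rightarrow> 'a \<Rightarrow> bool" where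
  "ug_walk G u p v \<longleftrightarrow>
     p \<noteq> [] \<and> hd p = u \<and> last p = v \<and> set p \<subseteq> ug_verts G \<and>
     successively (\<lambda>x y. {x, y} \<in> ug_edges G) p"

definition ug_connected :: "'a ugraph \<Rightarrow> bool" where
  "ug_connected G \<longleftrightarrow>
     ug_verts G \<noteq> {} \<and> (\<forall>u \<in> ug_verts G. \<forall>v \<in> ug_verts G. \<exists>p. ug_walk G u p v)"

text \<open>A cycle is listed without repeating its first vertex at the end.\<close>

definition ug_cycle :: "'a ugraph \<Rightarrow> 'a list \<Rightarrow> bool" where
  "ug_cycle G p \<longleftrightarrow>
     3 \<le> length p \<and> distinct p \<and> ug_walk G (hd p) p (last p) \<and> {last p, hd p} \<in> ug_edges G"

definition ug_tree :: "'a ugraph \<Rightarrow> bool" where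
  "ug_tree G \<longleftrightarrow> ug_simple G \<and> ug_connected G \<and> (\<nexists>p. ug_cycle G p)"

text \<open>Labeled spanning trees: trees with different edge sets are different.\<close>

definition ug_spanning_trees :: "'a ugraph \<Rightarrow> 'a ugraph set" where
  "ug_spanning_trees G = {T. ug_tree T \<and> ug_verts T = ug_verts G \<and> ug_edges T \<subseteq> ug_edges G}"

definition ug_degree :: "'a ugraph \<Rightarrow> 'a \<Rightarrow> nat" where
  "ug_degree G v = card {e \<in> ug_edges G. v \<in> e}"

definition ug_leaves :: "'a ugraph \<Rightarrow> 'a set" where
  "ug_leaves T = {v \<in> ug_verts T. ug_degree T v = 1}"

definition ug_total_leaves :: "'a ugraph \<Rightarrow> nat" where
  "ug_total_leaves G = (\<Sum>T \<in> ug_spanning_trees G. card (ug_leaves T))"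


section \<open>Powers of graphs and cycle graphs\<close>

text \<open>The distance is \<open>\<infinity>\<close> if there is no walk, as the infimum of the empty set.\<close>

definition ug_dist :: "'a ugraph \<Rightarrow> 'a \<Rightarrow> 'a \<Rightarrow> enat" where
  "ug_dist G u v = (INF p \<in> {p. ug_walk G u p v}. enat (length p - 1))"

definition ug_power :: "'a ugraph \<Rightarrow> nat \<Rightarrow> 'a ugraph" where
  "ug_power G k =
     (ug_verts G,
      {{u, v} | u v. u \<in> ug_verts G \<and> v \<in> ug_verts G \<and>
                     1 \<le> ug_dist G u v \<and> ug_dist G u v \<le> enat k})"

text \<open>Meaningful for \<open>n \<ge> 3\<close> only.\<close>

definition cycle_ugraph :: "nat \<Rightarrow> nat ugraph" where
  "cycle_ugraph n = ({0..<n}, {{i, (i + 1) mod n} | i. i < n})"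


section \<open>Well-formedness\<close>

lemma ug_simple_finite_edges:
  assumes "ug_simple G"
  shows "finite (ug_edges G)"
proof (rule finite_subset)
  show "ug_edges G \<subseteq> Pow (ug_verts G)"
    using assms by (auto simp: ug_simple_def)
  show "finite (Pow (ug_verts G))"
    using assms by (auto simp: ug_simple_def)
qed

text \<open>Hence the sum in \<^const>\<open>ug_total_leaves\<close> ranges over a finite set.\<close>

lemma finite_ug_spanning_trees:
  assumes "ug_simple G"
  shows "finite (ug_spanning_trees G)"
proof (rule finite_subset)
  show "ug_spanning_trees G \<subseteq> {ug_verts G} \<times> Pow (ug_edges G)"
    by (auto simp: ug_spanning_trees_def)
  show "finite ({ug_verts G} \<times> Pow (ug_edges G))"
    using ug_simple_finite_edges[OF assms] by simp
qed

lemma ug_dist_self: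
  assumes "u \<in> ug_verts G"
  shows "ug_dist G u u = 0"
proof -
  have "ug_walk G u [u] u"
    using assms by (simp add: ug_walk_def)
  then have "ug_dist G u u \<le> enat (length [u] - 1)"
    unfolding ug_dist_def by (intro INF_lower) simp
  then show ?thesis
    by (simp add: zero_enat_def [symmetric])
qed

lemma ug_simple_power:
  assumes "finite (ug_verts G)"
  shows "ug_simple (ug_power G k)"
proof -
  have "card {u, v} = 2" if "u \<in> ug_verts G" "1 \<le> ug_dist G u v" for u v
  proof -
    have "u \<noteq> v"
      using that ug_dist_self[of u G] by auto
    then show ?thesis by simp
  qed
  then show ?thesis
    using assms by (auto simp: ug_simple_def ug_power_def)
qed

lemma ug_simple_cycle_ugraph:
  assumes "3 \<le> n"
  shows "ug_simple (cycle_ugraph n)"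
proof -
  have "i \<noteq> Suc i mod n" if "i < n" for i
    using that assms by (cases "Suc i = n") auto
  then show ?thesis
    using assms by (auto simp: ug_simple_def cycle_ugraph_def card_2_iff)
qed


section \<open>The denominator\<close>

definition B4 :: "rat poly" where
  "B4 = (let t = [:0, 1:] in
     (t + 1) ^ 3 *
     (t ^ 6 - 3 * t ^ 5 + 6 * t ^ 4 - 10 * t ^ 3 + 6 * t ^ 2 - 3 * t + 1) ^ 3 *
     (t ^ 8 - 4 * t ^ 7 - 17 * t ^ 6 + 8 * t ^ 5 + 49 * t ^ 4 + 8 * t ^ 3 - 17 * t ^ 2
       - 4 * t + 1) ^ 3 *
     (t ^ 12 + 3 * t ^ 11 + 12 * t ^ 10 + 28 * t ^ 9 - 27 * t ^ 8 + 36 * t ^ 7 - 81 * t ^ 6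
       + 36 * t ^ 5 - 27 * t ^ 4 + 28 * t ^ 3 + 12 * t ^ 2 + 3 * t + 1) ^ 3)"

end

theory Submission
  imports Defs "Jordan_Normal_Form.Char_Poly"
begin

text \<open>
  Let \<open>L n\<close> be the total number of leaves for the cycle on \<open>n\<close> vertices. It is \<open>8 n\<close> times a
  determinant whose size grows with \<open>n\<close> but whose rows are translates of each other except for
  eight of them. Such a determinant is an exponential polynomial in \<open>n\<close>, and the bases of its
  exponentials can be listed.

  Rooting a spanning tree at a vertex \<open>r\<close> turns it into the map that sends every other vertex to its
  parent, and \<open>v \<noteq> r\<close> is a leaf iff it is nobody's parent. So the trees in which \<open>v\<close> is a leaf
  correspond to a free choice of one of the 8 neighbours of \<open>v\<close> together with a parent map on the
  graph without \<open>v\<close> (\<open>card_parent_maps_leaf\<close>). Acyclic maps are counted by a determinant: expand it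
  by multilinearity in the rows, one term for each map; the term of an acyclic map is 1, and that of
  any other map is 0 (\<open>det_eq_card_forest_maps\<close>, a version of the matrix tree theorem). The count is
  the same for all \<open>n\<close> vertices \<open>v\<close>, whence \<open>L n = 8 n det M\<close>, where \<open>M\<close> is the Laplacian matrix of
  the graph without \<open>v\<close> with the row of \<open>r\<close> replaced by a unit vector (\<open>total_leaves_eq_det\<close>).

  All rows of \<open>M\<close> but the first four and the last four are translates of the symbol
  \<open>8 - \<Sum>d=1..4. (x^d + x^(-d)) = (2 - u) ((u + 1)^3 + 3)\<close> with \<open>u = x + 1/x\<close>. They annihilate the
  eight sequences \<open>1\<close>, \<open>j\<close> and \<open>z^j\<close>, where \<open>z\<close> and \<open>1/z\<close> run through the six zeros of the symbol
  other than 1. With these sequences as the first eight columns of a block triangular multiplier,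
  \<open>det M\<close> reduces, up to the sign \<open>(-1)^n\<close> and a nonzero constant, to an 8 by 8 determinant in which
  the column of a sequence \<open>\<phi>\<close> is a fixed combination of \<open>\<phi>(s)\<close> and \<open>\<phi>(m + s)\<close>, \<open>s < 8\<close>, for
  \<open>m = n - 9\<close> (\<open>det_leaf_mat_reduction\<close>). So it is a combination of products, over the columns, of
  \<open>a + z^m b\<close> and of one factor linear in \<open>m\<close>. Hence \<open>L (m + 9)\<close> is a combination of the sequences
  \<open>m^k \<lambda>^m\<close> with \<open>k \<le> 2\<close> and \<open>- \<lambda>\<close> a product of some of the \<open>z\<close>. Taking at most one of \<open>z\<close>, \<open>1/z\<close>
  from each pair there are \<open>1 + 6 + 12 + 8\<close> such \<open>\<lambda>\<close>, according to the number of factors, and these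
  are the reciprocal zeros of the four factors of \<open>B4\<close> (\<open>base_poly_root\<close>); the cubes in \<open>B4\<close> account
  for \<open>k \<le> 2\<close>.

  The exponential polynomial satisfies the recurrence with coefficients \<open>B4\<close> on all integers, and
  \<open>deg B4 = 81\<close>. So \<open>B4\<close> times the generating function has no coefficient beyond \<open>t^80\<close>, and the
  coefficient of \<open>t^80\<close> is minus the value of the exponential polynomial at \<open>m = -1\<close>. There the 8 by 8
  determinant becomes that of an explicit integer matrix, which is invertible; so the degree is
  exactly 80.
\<close>

section \<open>Parent maps of spanning trees\<close>

text \<open>
  Acyclicity is expressed by a rank that drops along the map. Fixed points are admitted: they are the
  roots of a forest when the map is total on its index set, as it is in the determinant below.
\<close>

definition forest_map :: "'a set \<Rightarrow> ('a \<Rightarrow> 'a) \<Rightarrow> bool" where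
  "forest_map I f \<longleftrightarrow> (\<exists>d::'a \<Rightarrow> nat. \<forall>i\<in>I. f i \<noteq> i \<longrightarrow> d (f i) < d i)"

lemma ug_walk_single: "u \<in> ug_verts G \<Longrightarrow> ug_walk G u [u] u"
  by (simp add: ug_walk_def)

lemma ug_walk_Cons:
  assumes "ug_walk G w p v" "u \<in> ug_verts G" "{u, w} \<in> ug_edges G"
  shows "ug_walk G u (u # p) v"
  using assms by (cases p) (auto simp: ug_walk_def)

lemma ug_walk_rev: "ug_walk G u p v \<Longrightarrow> ug_walk G v (rev p) u"
  by (auto simp: ug_walk_def hd_rev last_rev insert_commute)

lemma ug_walk_append:
  assumes "ug_walk G u p v" "ug_walk G v q w"
  shows "ug_walk G u (p @ tl q) w"
proof (cases q)
  case (Cons a q')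
  with assms show ?thesis
    by (cases "q' = []") (auto simp: ug_walk_def successively_append_iff successively_Cons)
qed (use assms in \<open>auto simp: ug_walk_def\<close>)

lemma ug_walk_distinct:
  assumes "ug_walk G u p v"
  shows "\<exists>q. ug_walk G u q v \<and> distinct q"
proof -
  define q where "q = arg_min length (\<lambda>q. ug_walk G u q v)"
  have q: "ug_walk G u q v" and min: "\<And>q'. ug_walk G u q' v \<Longrightarrow> length q \<le> length q'"
    unfolding q_def using arg_min_nat_lemma[of "\<lambda>q. ug_walk G u q v" p length] assms by auto
  have "distinct q"
  proof (rule ccontr)
    assume "\<not> distinct q"
    then obtain a x b c where d: "q = a @ [x] @ b @ [x] @ c"
      using not_distinct_decomp by blast
    have "ug_walk G u (a @ [x] @ c) v"
    proof -
      let ?P = "\<lambda>x y. {x, y} \<in> ug_edges G"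
      have w: "successively ?P (a @ [x] @ b @ [x] @ c)" "hd (a @ [x]) = u" "last (x # c) = v"
        "set (a @ [x] @ c) \<subseteq> ug_verts G"
        using q unfolding d ug_walk_def by (auto simp: hd_append)
      then have "successively ?P ((a @ [x]) @ (b @ [x] @ c))" "successively ?P ((a @ [x] @ b) @ ([x] @ c))"
        by simp_all
      then have "successively ?P (a @ [x])" "successively ?P ([x] @ c)"
        unfolding successively_append_iff[of _ "a @ [x]"] successively_append_iff[of _ "a @ [x] @ b"]
        by blast+
      with w have "ug_walk G u (a @ [x]) x" "ug_walk G x (x # c) v"
        by (simp_all add: ug_walk_def)
      from ug_walk_append[OF this] show ?thesis by simp
    qed
    from min[OF this] show False by (simp add: d)
  qed
  with q show ?thesis by blast
qed

context
  fixes G :: "'a ugraph" and r :: 'a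
  assumes simp_G: "ug_simple G" and r: "r \<in> ug_verts G"
begin

definition parent_maps :: "('a \<Rightarrow> 'a) set" where
  "parent_maps = {f \<in> (ug_verts G - {r}) \<rightarrow>\<^sub>E ug_verts G.
     (\<forall>i \<in> ug_verts G - {r}. {i, f i} \<in> ug_edges G) \<and> forest_map (ug_verts G - {r}) f}"

definition parent_tree :: "('a \<Rightarrow> 'a) \<Rightarrow> 'a ugraph" where
  "parent_tree f = (ug_verts G, (\<lambda>i. {i, f i}) ` (ug_verts G - {r}))"

lemma edge_irrefl: "{i, j} \<in> ug_edges G \<Longrightarrow> i \<noteq> j"
  using simp_G by (auto simp: ug_simple_def)

lemma parent_mapsE:
  assumes "f \<in> parent_maps"
  obtains d :: "'a \<Rightarrow> nat" where
    "\<And>i. i \<in> ug_verts G \<Longrightarrow> i \<noteq> r \<Longrightarrow> d (f i) < d i"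
    "\<And>i. i \<in> ug_verts G \<Longrightarrow> i \<noteq> r \<Longrightarrow> {i, f i} \<in> ug_edges G"
    "\<And>i. i \<in> ug_verts G \<Longrightarrow> i \<noteq> r \<Longrightarrow> f i \<in> ug_verts G"
proof -
  from assms obtain d :: "'a \<Rightarrow> nat" where
    "\<And>i. i \<in> ug_verts G \<Longrightarrow> i \<noteq> r \<Longrightarrow> f i \<noteq> i \<Longrightarrow> d (f i) < d i"
    by (auto simp: parent_maps_def forest_map_def)
  then show ?thesis
    using assms edge_irrefl that[of d] by (fastforce simp: parent_maps_def)
qed

text \<open>
  Following parents from any vertex ends in the root, because the rank drops.
\<close>

lemma connected_parent_tree:
  assumes d: "\<And>i. i \<in> ug_verts G \<Longrightarrow> i \<noteq> r \<Longrightarrow> (d (f i) :: nat) < d i"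
    and V: "\<And>i. i \<in> ug_verts G \<Longrightarrow> i \<noteq> r \<Longrightarrow> f i \<in> ug_verts G"
  shows "ug_connected (parent_tree f)"
proof -
  have walk_to_root: "i \<in> ug_verts G \<Longrightarrow> \<exists>p. ug_walk (parent_tree f) i p r" for i
  proof (induction "d i" arbitrary: i rule: less_induct)
    case less
    show ?case
    proof (cases "i = r")
      case True
      then show ?thesis
        using ug_walk_single[of i "parent_tree f"] less.prems by (auto simp: parent_tree_def)
    next
      case False
      obtain p where "ug_walk (parent_tree f) (f i) p r"
        using less.hyps[OF d[OF less.prems False] V[OF less.prems False]] by blast
      then have "ug_walk (parent_tree f) i (i # p) r"
        by (rule ug_walk_Cons) (use less.prems False in \<open>auto simp: parent_tree_def\<close>)
      then show ?thesis by blast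
    qed
  qed
  show ?thesis
    unfolding ug_connected_def
  proof (intro conjI ballI)
    fix u v assume "u \<in> ug_verts (parent_tree f)" "v \<in> ug_verts (parent_tree f)"
    then obtain p q where "ug_walk (parent_tree f) u p r" "ug_walk (parent_tree f) v q r"
      using walk_to_root[of u] walk_to_root[of v] by (metis fst_conv parent_tree_def)
    then show "\<exists>p. ug_walk (parent_tree f) u p v"
      using ug_walk_append ug_walk_rev by metis
  qed (use r in \<open>auto simp: parent_tree_def\<close>)
qed

lemma acyclic_parent_tree:
  assumes d: "\<And>i. i \<in> ug_verts G \<Longrightarrow> i \<noteq> r \<Longrightarrow> (d (f i) :: nat) < d i"
  shows "\<not> ug_cycle (parent_tree f) p"
proof
  assume cyc: "ug_cycle (parent_tree f) p"
  define l where "l = length p"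
  have l: "3 \<le> l" and dist: "distinct p" and p: "set p \<subseteq> ug_verts G" "p \<noteq> []"
    using cyc by (auto simp: ug_cycle_def ug_walk_def l_def parent_tree_def)
  have step: "{p ! i, p ! ((i + 1) mod l)} \<in> ug_edges (parent_tree f)" if "i < l" for i
  proof (cases "i + 1 < l")
    case True
    then show ?thesis
      using cyc by (auto simp: ug_cycle_def ug_walk_def l_def successively_conv_nth)
  next
    case False
    with that have "i + 1 = l" by simp
    then have "i = l - 1" "(i + 1) mod l = 0" by auto
    then show ?thesis
      using cyc p(2) by (auto simp: ug_cycle_def l_def hd_conv_nth last_conv_nth)
  qed
  \<comment> \<open>The two neighbours on the cycle of a vertex of maximal rank are both its parent.\<close>
  have "Max (d ` set p) \<in> d ` set p"
    using p(2) by (intro Max_in) auto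
  then obtain x where x: "x \<in> set p" and dx: "Max (d ` set p) = d x"
    by blast
  have max: "d y \<le> d x" if "y \<in> set p" for y
    unfolding dx[symmetric] using that by (intro Max_ge) auto
  obtain i where i: "i < l" "x = p ! i"
    using x by (auto simp: in_set_conv_nth l_def)
  have parent: "y = f x" if "y \<in> set p" "{x, y} \<in> ug_edges (parent_tree f)" for y
  proof -
    obtain k where k: "k \<in> ug_verts G" "k \<noteq> r" "{x, y} = {k, f k}"
      using \<open>{x, y} \<in> _\<close> by (auto simp: parent_tree_def)
    have "\<not> (x = f k \<and> y = k)"
      using d[OF k(1,2)] max[OF that(1)] by auto
    with k(3) show ?thesis by (auto simp: doubleton_eq_iff)
  qed
  define j where "j = (i + l - 1) mod l"
  have jl: "j < l" and ji: "(j + 1) mod l = i"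
    using i(1) l by (auto simp: j_def mod_simps)
  have nj: "(i + 1) mod l \<noteq> j"
    using i(1) l by (auto simp: j_def mod_if)
  have "p ! ((i + 1) mod l) = f x"
    using step[OF i(1)] i l by (intro parent nth_mem) (auto simp: l_def intro!: mod_less_divisor)
  moreover have "p ! j = f x"
    using step[OF jl] ji jl i(2) by (intro parent nth_mem) (auto simp: l_def insert_commute)
  ultimately have "(i + 1) mod l = j"
    using dist jl l by (metis nth_eq_iff_index_eq l_def mod_less_divisor i(1) gr_implies_not0 neq0_conv)
  with nj show False ..
qed

text \<open>
  The tree determines the parents by induction on the rank: the edge between i and its parent in f
  can only come from i in g, since g agrees with f on the parent, which has smaller rank.
\<close>

lemma parent_tree_inj: "inj_on parent_tree parent_maps"
proof
  fix f g assume f: "f \<in> parent_maps" and g: "g \<in> parent_maps" and eq: "parent_tree f = parent_tree g"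
  obtain d where d: "\<And>i. i \<in> ug_verts G \<Longrightarrow> i \<noteq> r \<Longrightarrow> d (f i) < (d i :: nat)"
    "\<And>i. i \<in> ug_verts G \<Longrightarrow> i \<noteq> r \<Longrightarrow> f i \<in> ug_verts G"
    using parent_mapsE[OF f] by metis
  have "i \<in> ug_verts G \<Longrightarrow> i \<noteq> r \<Longrightarrow> f i = g i" for i
  proof (induction "d i" arbitrary: i rule: less_induct)
    case less
    have "{i, f i} \<in> ug_edges (parent_tree g)"
      using less.prems eq[symmetric] by (auto simp: parent_tree_def)
    then obtain k where k: "k \<in> ug_verts G" "k \<noteq> r" "{i, f i} = {k, g k}"
      by (auto simp: parent_tree_def)
    have "\<not> (i = g k \<and> f i = k)"
    proof
      assume *: "i = g k \<and> f i = k"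
      then have "f k = g k"
        using less.hyps[of k] d(1)[OF less.prems] k by auto
      with * show False
        using d(1)[OF less.prems] d(1)[OF k(1,2)] by auto
    qed
    with k(3) show ?case by (auto simp: doubleton_eq_iff)
  qed
  then show "f = g"
    using f g by (intro PiE_ext[of f "ug_verts G - {r}" "\<lambda>_. ug_verts G"]) (auto simp: parent_maps_def)
qed

lemma parent_tree_spanning:
  assumes "f \<in> parent_maps"
  shows "parent_tree f \<in> ug_spanning_trees G"
proof -
  obtain d :: "'a \<Rightarrow> nat" where d: 
    "\<And>i. i \<in> ug_verts G \<Longrightarrow> i \<noteq> r \<Longrightarrow> d (f i) < d i"
    "\<And>i. i \<in> ug_verts G \<Longrightarrow> i \<noteq> r \<Longrightarrow> {i, f i} \<in> ug_edges G"
    "\<And>i. i \<in> ug_verts G \<Longrightarrow> i \<noteq> r \<Longrightarrow> f i \<in> ug_verts G"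
    using parent_mapsE[OF assms] by metis
  have E: "ug_edges (parent_tree f) \<subseteq> ug_edges G"
    using d(2) by (auto simp: parent_tree_def)
  moreover have "ug_verts (parent_tree f) = ug_verts G"
    by (simp add: parent_tree_def)
  ultimately have "ug_simple (parent_tree f)"
    using simp_G unfolding ug_simple_def by (metis subsetD)
  then show ?thesis
    using E connected_parent_tree[of d f] acyclic_parent_tree[of d f] d
    by (auto simp: ug_spanning_trees_def ug_tree_def) (auto simp: parent_tree_def)
qed

text \<open>
  The parent of a vertex is the second vertex of a shortest walk to the root, and the rank is the
  length of such a walk.
\<close>

lemma spanning_tree_parent:
  assumes "T \<in> ug_spanning_trees G"
  shows "\<exists>f \<in> parent_maps. parent_tree f = T"
proof -
  have V: "ug_verts T = ug_verts G" and E: "ug_edges T \<subseteq> ug_edges G"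
    and T: "ug_simple T" "ug_connected T" "\<And>p. \<not> ug_cycle T p"
    using assms by (auto simp: ug_spanning_trees_def ug_tree_def)
  define q where "q v = arg_min length (\<lambda>p. ug_walk T v p r)" for v
  define d where "d v = length (q v)" for v
  define f where "f = restrict (\<lambda>v. hd (tl (q v))) (ug_verts G - {r})"
  have q: "ug_walk T v (q v) r" if "v \<in> ug_verts G" for v
  proof -
    have "\<exists>p. ug_walk T v p r"
      using T(2) that r V unfolding ug_connected_def by metis
    then show ?thesis unfolding q_def by (metis arg_min_natI)
  qed
  have min: "d v \<le> length p" if "ug_walk T v p r" for p v
    unfolding d_def q_def using that by (rule arg_min_nat_le)
  have step: "d (f v) < d v \<and> {v, f v} \<in> ug_edges T \<and> f v \<in> ug_verts G"
    if v: "v \<in> ug_verts G" "v \<noteq> r" for v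
  proof -
    obtain w p where qv: "q v = v # w # p"
      using q[OF v(1)] v(2) unfolding ug_walk_def
      by (metis hd_Cons_tl last_ConsL)
    then have "ug_walk T w (w # p) r"
      using q[OF v(1)] by (auto simp: ug_walk_def)
    from min[OF this] show ?thesis
      using q[OF v(1)] v V by (auto simp: f_def qv d_def ug_walk_def)
  qed
  have f: "f \<in> parent_maps"
    using step E by (auto simp: parent_maps_def forest_map_def f_def intro!: exI[of _ d])
  have sub: "ug_edges (parent_tree f) \<subseteq> ug_edges T"
    using step by (auto simp: parent_tree_def)
  \<comment> \<open>An edge of T outside the parent tree would close a path of the parent tree to a cycle of T.\<close>
  have "e \<in> ug_edges (parent_tree f)" if e: "e \<in> ug_edges T" for e
  proof (rule ccontr)
    assume not: "e \<notin> ug_edges (parent_tree f)"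
    have "card e = 2" "e \<subseteq> ug_verts G"
      using e T(1) V by (auto simp: ug_simple_def)
    then obtain u v where uv: "e = {u, v}" "u \<noteq> v" "u \<in> ug_verts G" "v \<in> ug_verts G"
      by (auto simp: card_2_iff)
    have "ug_connected (parent_tree f)"
      using step by (intro connected_parent_tree[of d]) auto
    then obtain p where p: "ug_walk (parent_tree f) u p v" "distinct p"
      using uv ug_walk_distinct unfolding ug_connected_def by (metis fst_conv parent_tree_def)
    have "3 \<le> length p"
    proof (rule ccontr)
      assume "\<not> 3 \<le> length p"
      then have "length p = 0 \<or> length p = 1 \<or> length p = 2" by linarith
      then show False
        using p(1) uv not
        by (auto simp: ug_walk_def length_Suc_conv numeral_2_eq_2)
    qed
    moreover have "ug_walk T u p v"
      using p(1) sub V unfolding ug_walk_def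
      by (auto simp: parent_tree_def elim!: successively_mono)
    ultimately have "ug_cycle T p"
      using p e uv unfolding ug_cycle_def ug_walk_def by (auto simp: insert_commute)
    with T(3) show False by blast
  qed
  with sub have "ug_edges (parent_tree f) = ug_edges T" by blast
  then have "parent_tree f = T"
    using V by (simp add: parent_tree_def prod_eq_iff)
  with f show ?thesis by blast
qed

theorem bij_betw_parent_tree: "bij_betw parent_tree parent_maps (ug_spanning_trees G)"
  unfolding bij_betw_def
  by (intro conjI parent_tree_inj equalityI subsetI)
    (use parent_tree_spanning spanning_tree_parent in blast)+

text \<open>
  A vertex other than the root always has the edge to its parent, so it is a leaf iff it has no child.
\<close>

lemma leaf_parent_tree_iff:
  assumes f: "f \<in> parent_maps" and v: "v \<in> ug_verts G" "v \<noteq> r"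
  shows "v \<in> ug_leaves (parent_tree f) \<longleftrightarrow> (\<forall>i \<in> ug_verts G - {r}. f i \<noteq> v)"
proof -
  obtain d where d: "\<And>i. i \<in> ug_verts G \<Longrightarrow> i \<noteq> r \<Longrightarrow> d (f i) < (d i :: nat)"
    using parent_mapsE[OF f] by metis
  let ?E = "{e \<in> ug_edges (parent_tree f). v \<in> e}"
  have own: "{v, f v} \<in> ?E"
    using v by (auto simp: parent_tree_def)
  have "card ?E = 1 \<longleftrightarrow> ?E = {{v, f v}}"
  proof
    assume "card ?E = 1"
    then show "?E = {{v, f v}}"
      using own by (metis (no_types, lifting) card_1_singletonE singletonD)
  qed simp
  also have "\<dots> \<longleftrightarrow> (\<forall>i \<in> ug_verts G - {r}. f i \<noteq> v)"
  proof
    assume *: "?E = {{v, f v}}"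
    show "\<forall>i \<in> ug_verts G - {r}. f i \<noteq> v"
    proof (intro ballI notI)
      fix i assume i: "i \<in> ug_verts G - {r}" "f i = v"
      have "{i, f i} \<in> ug_edges (parent_tree f)"
        using i(1) unfolding parent_tree_def snd_conv by (rule imageI)
      with i(2) have "{i, f i} \<in> ?E" by simp
      then have "{i, f i} = {v, f v}" unfolding * by simp
      then have "i = v \<or> i = f v" by blast
      moreover have "d v < d i" "d (f v) < d v"
        using d[of i] d[of v] i v by simp_all
      ultimately show False by (metis less_irrefl less_trans)
    qed
  next
    assume *: "\<forall>i \<in> ug_verts G - {r}. f i \<noteq> v"
    have "e = {v, f v}" if "e \<in> ?E" for e
    proof -
      from that have "e \<in> (\<lambda>i. {i, f i}) ` (ug_verts G - {r})" and ve: "v \<in> e"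
        unfolding parent_tree_def by simp_all
      then obtain i where "i \<in> ug_verts G - {r}" "e = {i, f i}" by blast
      with * ve show ?thesis by auto
    qed
    with own show "?E = {{v, f v}}" by blast
  qed
  finally have "card ?E = 1 \<longleftrightarrow> (\<forall>i \<in> ug_verts G - {r}. f i \<noteq> v)" .
  moreover have "v \<in> ug_verts (parent_tree f)"
    using v by (simp add: parent_tree_def)
  ultimately show ?thesis
    unfolding ug_leaves_def ug_degree_def by blast
qed

end

section \<open>Counting acyclic maps by a determinant\<close>

lemma det_rows_sum:
  fixes h :: "nat \<Rightarrow> 'b \<Rightarrow> nat \<Rightarrow> 'a :: comm_ring_1"
  assumes "\<And>i. i < n \<Longrightarrow> finite (S i)"
  shows "det (mat n n (\<lambda>(i, k). \<Sum>j\<in>S i. h i j k)) =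
    (\<Sum>f \<in> Pi\<^sub>E {0..<n} S. det (mat n n (\<lambda>(i, k). h i (f i) k)))"
proof -
  let ?P = "{p. p permutes {0..<n}}"
  have "det (mat n n (\<lambda>(i, k). \<Sum>j\<in>S i. h i j k)) =
      (\<Sum>p\<in>?P. signof p * (\<Prod>i=0..<n. \<Sum>j\<in>S i. h i j (p i)))"
    by (subst det_def'[of _ n]) (auto intro!: sum.cong prod.cong dest: permutes_in_image)
  also have "\<dots> = (\<Sum>p\<in>?P. \<Sum>f\<in>Pi\<^sub>E {0..<n} S. signof p * (\<Prod>i=0..<n. h i (f i) (p i)))"
    using assms by (subst prod_sum_PiE) (auto simp: sum_distrib_left)
  also have "\<dots> = (\<Sum>f\<in>Pi\<^sub>E {0..<n} S. \<Sum>p\<in>?P. signof p * (\<Prod>i=0..<n. h i (f i) (p i)))"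
    by (rule sum.swap)
  also have "\<dots> = (\<Sum>f \<in> Pi\<^sub>E {0..<n} S. det (mat n n (\<lambda>(i, k). h i (f i) k)))"
    by (subst det_def'[of _ n]) (auto intro!: sum.cong prod.cong dest: permutes_in_image)
  finally show ?thesis .
qed

text \<open>
  Row i of the contribution of a map sending i to j: the difference of the unit vectors of i and j, or
  only the unit vector of i if i is a fixed point, that is, a root.
\<close>

definition hop :: "nat \<Rightarrow> nat \<Rightarrow> nat \<Rightarrow> 'a :: comm_ring_1" where
  "hop i j k = (if k = i then 1 else 0) - (if j \<noteq> i \<and> k = j then 1 else 0)"

text \<open>
  Sorted by rank the matrix is unitriangular; the Leibniz formula gives the same without sorting.
\<close>

lemma det_hop_forest:
  assumes "forest_map {0..<n} f"
  shows "det (mat n n (\<lambda>(i, k). hop i (f i) k)) = (1 :: 'a :: comm_ring_1)"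
proof -
  let ?P = "{p. p permutes {0..<n}}"
  obtain d where "\<forall>i\<in>{0..<n}. f i \<noteq> i \<longrightarrow> d (f i) < (d i :: nat)"
    using assms unfolding forest_map_def by blast
  then have d: "d (f i) < d i" if "i < n" "f i \<noteq> i" for i
    using that by simp
  have zero: "(\<Prod>i=0..<n. hop i (f i) (p i)) = (0 :: 'a)" if p: "p permutes {0..<n}" "p \<noteq> id" for p
  proof (rule ccontr)
    assume nz: "(\<Prod>i=0..<n. hop i (f i) (p i)) \<noteq> (0 :: 'a)"
    have "hop i (f i) (p i) \<noteq> (0 :: 'a)" if "i < n" for i
      using nz that by (metis (no_types, lifting) atLeastLessThan_iff finite_atLeastLessThan prod_zero zero_le)
    then have pi: "p i = i \<or> f i \<noteq> i \<and> p i = f i" if "i < n" for i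
      using that by (fastforce simp: hop_def split: if_splits)
    then have le: "d (p i) \<le> d i" if "i < n" for i
      using d[OF that] that by (metis le_eq_less_or_eq)
    \<comment> \<open>A permutation that never increases the rank keeps it, because the rank sum is invariant.\<close>
    have "(\<Sum>i=0..<n. d (p i)) = (\<Sum>i=0..<n. d i)"
      using sum.permute[OF p(1), of d] by (simp add: o_def)
    then have "d (p i) = d i" if "i < n" for i
      using sum_mono_inv[of "\<lambda>i. d (p i)" "{0..<n}" d i] le that by simp
    then have "p i = i" if "i < n" for i
      using pi[OF that] d[OF that] that by (metis less_irrefl)
    then have "p = id"
      using p(1) unfolding permutes_def by (intro ext) (metis atLeastLessThan_iff id_apply le0)
    with p(2) show False ..
  qed
  have "det (mat n n (\<lambda>(i, k). hop i (f i) k)) =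
      (\<Sum>p\<in>?P. signof p * (\<Prod>i=0..<n. hop i (f i) (p i) :: 'a))"
    by (subst det_def'[of _ n]) (auto intro!: sum.cong prod.cong dest: permutes_in_image)
  also have "\<dots> = (\<Sum>p\<in>{id}. signof p * (\<Prod>i=0..<n. hop i (f i) (p i) :: 'a))"
    by (intro sum.mono_neutral_right) (auto simp: finite_permutations permutes_id zero)
  also have "\<dots> = 1"
    by (auto simp: hop_def intro!: prod.neutral)
  finally show ?thesis .
qed

lemma det_hop_not_forest:
  assumes f: "\<And>i. i < n \<Longrightarrow> f i < n" and nf: "\<not> forest_map {0..<n} f"
  shows "det (mat n n (\<lambda>(i, k). hop i (f i) k)) = (0 :: 'a :: idom)"
proof -
  \<comment> \<open>If every orbit became stationary, the time until then would be a rank.\<close>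
  define d where "d i = (LEAST k. f ((f ^^ k) i) = (f ^^ k) i)" for i
  define C where "C = {i. i < n \<and> (\<forall>k. f ((f ^^ k) i) \<noteq> (f ^^ k) i)}"
  have "\<not> (\<forall>i\<in>{0..<n}. f i \<noteq> i \<longrightarrow> d (f i) < d i)"
    using nf unfolding forest_map_def by blast
  then have "\<exists>i. i < n \<and> f i \<noteq> i \<and> \<not> d (f i) < d i"
    by auto
  then obtain i where i: "i < n" "f i \<noteq> i" "\<not> d (f i) < d i" by blast
  have "i \<in> C"
  proof (rule ccontr)
    assume "i \<notin> C"
    then obtain k where "f ((f ^^ k) i) = (f ^^ k) i"
      using i(1) by (auto simp: C_def)
    then have fix_d: "f ((f ^^ d i) i) = (f ^^ d i) i"
      unfolding d_def by (rule LeastI)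
    then obtain e where e: "d i = Suc e"
      using i(2) by (cases "d i") auto
    have "f ((f ^^ e) (f i)) = (f ^^ e) (f i)"
      using fix_d unfolding e by (simp add: funpow_swap1)
    then have "d (f i) \<le> e"
      unfolding d_def by (rule Least_le)
    with i(3) e show False by simp
  qed
  have C: "f i \<in> C \<longleftrightarrow> i \<in> C" if "i < n" "f i \<noteq> i" for i
  proof -
    have "(\<forall>k. f ((f ^^ k) i) \<noteq> (f ^^ k) i) \<longleftrightarrow> (\<forall>k. f ((f ^^ Suc k) i) \<noteq> (f ^^ Suc k) i)"
      using that(2) by (metis funpow_0 old.nat.exhaust)
    then show ?thesis
      using f that(1) by (simp add: C_def funpow_swap1)
  qed
  have C': "i \<notin> C" if "f i = i" for i
    using that by (auto simp: C_def intro: exI[of _ 0])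
  \<comment> \<open>The indicator vector of the vertices whose orbit is never stationary lies in the kernel.\<close>
  define v where "v = vec n (\<lambda>k. if k \<in> C then 1 else 0 :: 'a)"
  have "mat n n (\<lambda>(i, k). hop i (f i) k) *\<^sub>v v = 0\<^sub>v n"
  proof (rule eq_vecI)
    fix i assume "i < dim_vec (0\<^sub>v n :: 'a vec)"
    then have i: "i < n" by simp
    have "(mat n n (\<lambda>(i, k). hop i (f i) k) *\<^sub>v v) $ i =
        (\<Sum>k=0..<n. hop i (f i) k * (if k \<in> C then 1 else 0))"
      using i by (simp add: scalar_prod_def v_def)
    also have "\<dots> = (\<Sum>k=0..<n. (if k = i then if i \<in> C then 1 else 0 else 0) -
        (if k = f i then if f i \<noteq> i \<and> f i \<in> C then 1 else 0 else 0))"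
      by (intro sum.cong) (auto simp: hop_def)
    also have "\<dots> = 0"
      using i f[OF i] C[OF i] C'[of i] by (auto simp: sum_subtractf)
    finally show "(mat n n (\<lambda>(i, k). hop i (f i) k) *\<^sub>v v) $ i = 0\<^sub>v n $ i"
      using i by simp
  qed simp
  moreover have "v \<noteq> 0\<^sub>v n"
  proof
    assume "v = 0\<^sub>v n"
    then have "v $ i = 0\<^sub>v n $ i" by simp
    with \<open>i \<in> C\<close> i(1) show False by (simp add: v_def)
  qed
  moreover have "v \<in> carrier_vec n"
    by (simp add: v_def)
  ultimately show ?thesis
    using det_0_iff_vec_prod_zero[of "mat n n (\<lambda>(i, k). hop i (f i) k) :: 'a mat" n] by auto
qed

theorem det_eq_card_forest_maps:
  assumes S: "\<And>i. i < n \<Longrightarrow> S i \<subseteq> {0..<n}"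
  shows "det (mat n n (\<lambda>(i, k). \<Sum>j\<in>S i. hop i j k)) =
    (of_nat (card {f \<in> Pi\<^sub>E {0..<n} S. forest_map {0..<n} f}) :: 'a :: idom)"
proof -
  have fin: "finite (S i)" if "i < n" for i
    using S[OF that] finite_subset by blast
  have "det (mat n n (\<lambda>(i, k). \<Sum>j\<in>S i. hop i j k)) =
      (\<Sum>f \<in> Pi\<^sub>E {0..<n} S. det (mat n n (\<lambda>(i, k). hop i (f i) k)) :: 'a)"
    using fin by (rule det_rows_sum)
  also have "\<dots> = (\<Sum>f \<in> Pi\<^sub>E {0..<n} S. if forest_map {0..<n} f then 1 else 0)"
  proof (rule sum.cong)
    fix f assume "f \<in> Pi\<^sub>E {0..<n} S"
    then have "f i < n" if "i < n" for i
      using S[OF that] that by (fastforce simp: PiE_iff)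
    then show "det (mat n n (\<lambda>(i, k). hop i (f i) k)) = (if forest_map {0..<n} f then 1 else 0 :: 'a)"
      by (simp add: det_hop_forest det_hop_not_forest)
  qed simp
  also have "\<dots> = of_nat (card {f \<in> Pi\<^sub>E {0..<n} S. forest_map {0..<n} f})"
    using sum.inter_filter[of "Pi\<^sub>E {0..<n} S" "\<lambda>_. 1 :: 'a" "forest_map {0..<n}"]
      finite_PiE[of "{0..<n}" S] fin
    by simp
  finally show ?thesis .
qed

section \<open>Spanning trees with a given leaf\<close>

text \<open>
  A leaf v can be attached to any of its neighbours, independently of the parent map on the remaining
  vertices. These are numbered by s, so that the parent maps become the forest maps on an initial
  segment of the naturals whose only fixed point is the number of the root.
\<close>

lemma card_parent_maps_leaf:
  fixes G :: "'a ugraph" and s :: "nat \<Rightarrow> 'a"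
  assumes G: "ug_simple G" and v: "v \<in> ug_verts G"
    and s: "bij_betw s {0..<N} (ug_verts G - {v})" and rho: "\<rho> < N"
  defines "S \<equiv> (\<lambda>i. if i = \<rho> then {\<rho>} else {j. j < N \<and> {s i, s j} \<in> ug_edges G})"
  shows "card {f \<in> parent_maps G (s \<rho>). \<forall>i \<in> ug_verts G - {s \<rho>}. f i \<noteq> v} =
    card {w. {v, w} \<in> ug_edges G} * card {g \<in> Pi\<^sub>E {0..<N} S. forest_map {0..<N} g}"
proof -
  let ?V = "ug_verts G" and ?E = "ug_edges G" and ?r = "s \<rho>"
  let ?A = "{f \<in> parent_maps G ?r. \<forall>i \<in> ?V - {?r}. f i \<noteq> v}"
  let ?W = "{w. {v, w} \<in> ?E}"
  let ?B = "{g \<in> Pi\<^sub>E {0..<N} S. forest_map {0..<N} g}"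
  have r: "?r \<in> ?V" "?r \<noteq> v"
    using bij_betwE[OF s] rho by auto
  define t where "t = inv_into {0..<N} s"
  have ts: "t (s i) = i" if "i < N" for i
    unfolding t_def using s that by (simp add: bij_betw_inv_into_left)
  have st: "s (t x) = x" if "x \<in> ?V" "x \<noteq> v" for x
    unfolding t_def using s that by (simp add: bij_betw_inv_into_right)
  have tN: "t x < N" if "x \<in> ?V" "x \<noteq> v" for x
    using bij_betwE[OF bij_betw_inv_into[OF s]] that by (auto simp: t_def)
  have sV: "s i \<in> ?V" "s i \<noteq> v" if "i < N" for i
    using bij_betwE[OF s] that by auto
  have t_rho: "t ?r = \<rho>" using ts rho by simp
  have irr: "x \<noteq> y" if "{x, y} \<in> ?E" for x y
    using G that by (auto simp: ug_simple_def)
  have EV: "y \<in> ?V" if "{x, y} \<in> ?E" for x y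
    using G that by (auto simp: ug_simple_def)
  define enc where "enc f = (f v, restrict (\<lambda>i. if i = \<rho> then \<rho> else t (f (s i))) {0..<N})" for f
  define dec where "dec = (\<lambda>(w, g). restrict (\<lambda>x. if x = v then w else s (g (t x))) (?V - {?r}))"
  have mA: "f \<in> ?A \<Longrightarrow> x \<in> ?V \<Longrightarrow> x \<noteq> ?r \<Longrightarrow> {x, f x} \<in> ?E \<and> f x \<in> ?V \<and> f x \<noteq> v" for f x
    using G r(1) by (auto simp: parent_maps_def)
  have sr: "s i \<noteq> ?r" if "i < N" "i \<noteq> \<rho>" for i
    using ts t_rho that by metis
  have mB: "{s i, s (g i)} \<in> ?E \<and> g i < N" if "g \<in> ?B" "i < N" "i \<noteq> \<rho>" for g i
  proof -
    have "g i \<in> S i" using that by (simp add: PiE_iff)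
    with that show ?thesis by (simp add: S_def)
  qed
  have mBr: "g \<rho> = \<rho>" if "g \<in> ?B" for g
  proof -
    have "g \<rho> \<in> S \<rho>" using that rho by (simp add: PiE_iff)
    then show ?thesis by (simp add: S_def)
  qed
  have "bij_betw enc ?A (?W \<times> ?B)"
  proof (rule bij_betw_byWitness[where f' = "dec"])
    show "\<forall>f\<in>?A. dec (enc f) = f"
    proof
      fix f assume f: "f \<in> ?A"
      have ext: "f x = undefined" if "x \<notin> ?V - {?r}" for x
        using f that unfolding parent_maps_def[OF G r(1)] by (auto simp: PiE_iff extensional_def)
      have val: "s (if t x = \<rho> then \<rho> else t (f (s (t x)))) = f x"
        if x: "x \<in> ?V" "x \<noteq> ?r" "x \<noteq> v" for x
        using mA[OF f x(1,2)] st[OF x(1,3)] x(2) st[of "f x"] by auto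
      show "dec (enc f) = f"
      proof
        fix x
        show "dec (enc f) x = f x"
          using val[of x] ext[of x] tN[of x]
          by (cases "x \<in> ?V - {?r}") (auto simp: dec_def enc_def)
      qed
    qed
    show "\<forall>p\<in>?W \<times> ?B. enc (dec p) = p"
    proof
      fix p assume "p \<in> ?W \<times> ?B"
      then obtain w g where p: "p = (w, g)" and w: "w \<in> ?W" and g: "g \<in> ?B" by auto
      have pv: "dec p v = w" using v r by (auto simp: dec_def p)
      have on: "(if i = \<rho> then \<rho> else t (dec p (s i))) = g i" if "i < N" for i
        using mB[OF g that] mBr[OF g] sV[OF that] sr[OF that] ts that
        by (auto simp: dec_def p)
      have off: "g i = undefined" if "\<not> i < N" for i
        using g that by (auto simp: PiE_iff extensional_def)
      have pg: "restrict (\<lambda>i. if i = \<rho> then \<rho> else t (dec p (s i))) {0..<N} = g"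
      proof
        fix i
        show "restrict (\<lambda>i. if i = \<rho> then \<rho> else t (dec p (s i))) {0..<N} i = g i"
          using on[of i] off[of i] by (cases "i < N") simp_all
      qed
      show "enc (dec p) = p"
        unfolding enc_def pv pg by (rule p[symmetric])
    qed
    show "enc ` ?A \<subseteq> ?W \<times> ?B"
    proof
      fix p assume "p \<in> enc ` ?A"
      then obtain f where p: "p = enc f" and f: "f \<in> ?A" by blast
      obtain d where d: "\<And>x. x \<in> ?V \<Longrightarrow> x \<noteq> ?r \<Longrightarrow> d (f x) < (d x :: nat)"
        using parent_mapsE[OF G r(1)] f by (metis (no_types, lifting) mem_Collect_eq)
      have "f v \<in> ?W" using mA[OF f v] r by auto
      moreover have "snd (enc f) i \<in> S i" if "i < N" for i
        using mA[OF f sV(1)[OF that] sr[OF that]] that tN st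
        by (auto simp: enc_def S_def)
      moreover have "forest_map {0..<N} (snd (enc f))"
        unfolding forest_map_def
      proof (intro exI[of _ "\<lambda>i. d (s i)"] ballI impI)
        fix i assume i: "i \<in> {0..<N}" "snd (enc f) i \<noteq> i"
        then have "i < N" "i \<noteq> \<rho>" by (auto simp: enc_def)
        then show "d (s (snd (enc f) i)) < d (s i)"
          using mA[OF f sV(1) sr] d[OF sV(1) sr] st by (auto simp: enc_def)
      qed
      ultimately show "p \<in> ?W \<times> ?B"
        by (auto simp: p enc_def PiE_iff)
    qed
    show "dec ` (?W \<times> ?B) \<subseteq> ?A"
    proof
      fix f assume "f \<in> dec ` (?W \<times> ?B)"
      then obtain w g where f: "f = dec (w, g)" and w: "w \<in> ?W" and g: "g \<in> ?B" by auto
      obtain d where d: "\<forall>i\<in>{0..<N}. g i \<noteq> i \<longrightarrow> d (g i) < (d i :: nat)"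
        using g by (auto simp: forest_map_def)
      have fv: "f v = w" using v r by (auto simp: dec_def f)
      have fx: "f x = s (g (t x))" if "x \<in> ?V" "x \<noteq> ?r" "x \<noteq> v" for x
        using that by (auto simp: dec_def f)
      have t_ne: "t x \<noteq> \<rho>" if "x \<in> ?V" "x \<noteq> ?r" "x \<noteq> v" for x
        using st that by metis
      have wV: "w \<in> ?V" "w \<noteq> v" using w EV irr by auto
      have edge: "{x, f x} \<in> ?E \<and> f x \<noteq> v" if x: "x \<in> ?V" "x \<noteq> ?r" for x
        using mB[OF g tN t_ne] fx x w st sV fv wV by (cases "x = v") auto
      \<comment> \<open>The new vertex v gets a rank just above that of its only neighbour.\<close>
      define d' where "d' x = (if x = v then Suc (d (t w)) else d (t x))" for x
      have "d' (f x) < d' x" if x: "x \<in> ?V" "x \<noteq> ?r" for x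
      proof (cases "x = v")
        case True
        then show ?thesis using fv wV by (simp add: d'_def)
      next
        case False
        have "g (t x) < N" "{x, f x} \<in> ?E"
          using mB[OF g tN t_ne] edge x False by auto
        moreover have "g (t x) \<noteq> t x"
          using irr[OF calculation(2)] fx[OF x False] st[OF x(1) False] by auto
        ultimately show ?thesis
          using d tN[OF x(1) False] fx[OF x False] ts sV False by (simp add: d'_def)
      qed
      then have "forest_map (?V - {?r}) f"
        by (auto simp: forest_map_def)
      moreover have "f \<in> (?V - {?r}) \<rightarrow>\<^sub>E ?V"
      proof (rule PiE_I)
        show "f x \<in> ?V" if "x \<in> ?V - {?r}" for x
          using EV[of x "f x"] edge[of x] that by blast
        show "f x = undefined" if "x \<notin> ?V - {?r}" for x
          unfolding f dec_def prod.case using that by (simp only: restrict_apply if_False)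
      qed
      ultimately show "f \<in> ?A"
        using edge G r(1) by (auto simp: parent_maps_def)
    qed
  qed
  then show ?thesis
    by (simp add: bij_betw_same_card card_cartesian_product)
qed

theorem card_spanning_trees_leaf:
  fixes G :: "'a ugraph" and s :: "nat \<Rightarrow> 'a"
  assumes G: "ug_simple G" and v: "v \<in> ug_verts G"
    and s: "bij_betw s {0..<N} (ug_verts G - {v})" and rho: "\<rho> < N"
  shows "of_nat (card {T \<in> ug_spanning_trees G. v \<in> ug_leaves T}) =
    of_nat (card {w. {v, w} \<in> ug_edges G}) *
    (det (mat N N (\<lambda>(i, k). \<Sum>j \<in> (if i = \<rho> then {\<rho>} else {j. j < N \<and> {s i, s j} \<in> ug_edges G}).
        hop i j k)) :: 'b :: idom)"
proof -
  let ?S = "\<lambda>i. if i = \<rho> then {\<rho>} else {j. j < N \<and> {s i, s j} \<in> ug_edges G}"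
  have r: "s \<rho> \<in> ug_verts G" "s \<rho> \<noteq> v"
    using bij_betwE[OF s] rho by auto
  have "bij_betw (parent_tree G (s \<rho>))
      {f \<in> parent_maps G (s \<rho>). \<forall>i \<in> ug_verts G - {s \<rho>}. f i \<noteq> v}
      {T \<in> ug_spanning_trees G. v \<in> ug_leaves T}"
    by (rule bij_betw_Collect[OF bij_betw_parent_tree[OF G r(1)]])
      (rule leaf_parent_tree_iff[OF G r(1) _ v r(2)[symmetric]])
  then have trees: "card {T \<in> ug_spanning_trees G. v \<in> ug_leaves T} =
      card {f \<in> parent_maps G (s \<rho>). \<forall>i \<in> ug_verts G - {s \<rho>}. f i \<noteq> v}"
    by (rule bij_betw_same_card[THEN sym])
  have det: "det (mat N N (\<lambda>(i, k). \<Sum>j \<in> ?S i. hop i j k)) =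
      (of_nat (card {g \<in> Pi\<^sub>E {0..<N} ?S. forest_map {0..<N} g}) :: 'b)"
  proof (rule det_eq_card_forest_maps)
    show "?S i \<subseteq> {0..<N}" if "i < N" for i
      using rho by (cases "i = \<rho>") auto
  qed
  show ?thesis
    unfolding trees card_parent_maps_leaf[OF G v s rho] of_nat_mult det ..
qed

section \<open>Adjacency in powers of cycles\<close>

text \<open>
  An infimum of a nonempty set of extended naturals is attained.
\<close>

lemma ug_dist_le_iff: "ug_dist G u v \<le> enat k \<longleftrightarrow> (\<exists>p. ug_walk G u p v \<and> length p - 1 \<le> k)"
proof
  assume le: "ug_dist G u v \<le> enat k"
  show "\<exists>p. ug_walk G u p v \<and> length p - 1 \<le> k"
  proof (rule ccontr)
    assume "\<not> ?thesis"
    then have "enat (Suc k) \<le> ug_dist G u v"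
      unfolding ug_dist_def by (intro INF_greatest) force
    then have "enat (Suc k) \<le> enat k" using le by (rule order_trans)
    then show False by simp
  qed
next
  assume "\<exists>p. ug_walk G u p v \<and> length p - 1 \<le> k"
  then obtain p where p: "ug_walk G u p v" "length p - 1 \<le> k" by blast
  then have "ug_dist G u v \<le> enat (length p - 1)"
    unfolding ug_dist_def by (intro INF_lower) simp
  also have "\<dots> \<le> enat k" using p(2) by simp
  finally show "ug_dist G u v \<le> enat k" .
qed

lemma ug_dist_ge_1_iff:
  assumes "u \<in> ug_verts G"
  shows "1 \<le> ug_dist G u v \<longleftrightarrow> u \<noteq> v"
proof
  assume "u \<noteq> v"
  then have "\<not> ug_dist G u v \<le> enat 0"
    unfolding ug_dist_le_iff by (auto simp: ug_walk_def le_Suc_eq length_Suc_conv)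
  then show "1 \<le> ug_dist G u v"
    by (simp add: zero_enat_def[symmetric] one_eSuc ileI1)
next
  assume "1 \<le> ug_dist G u v"
  then show "u \<noteq> v" using ug_dist_self[OF assms] by auto
qed

lemma cycle_edge_cases:
  assumes "{x, y} \<in> ug_edges (cycle_ugraph n)"
  shows "\<exists>d. \<bar>d\<bar> \<le> 1 \<and> int n dvd int y - int x - d"
proof -
  obtain i where "i < n" "{x, y} = {i, (i + 1) mod n}"
    using assms by (auto simp: cycle_ugraph_def)
  moreover have A: "int n dvd int ((i + 1) mod n) - int i - 1" for i
    by (simp add: zmod_int mod_eq_dvd_iff[symmetric] mod_simps algebra_simps)
  moreover have "int n dvd int i - int ((i + 1) mod n) - (- 1)" for i
  proof -
    have "int n dvd - (int ((i + 1) mod n) - int i - 1)"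
      using A[of i] by (simp only: dvd_minus_iff)
    then show ?thesis by (simp add: algebra_simps)
  qed
  moreover have "\<bar>1 :: int\<bar> \<le> 1" "\<bar>- 1 :: int\<bar> \<le> 1" by simp_all
  ultimately show ?thesis
    unfolding doubleton_eq_iff by blast
qed

text \<open>
  Each step of a walk on the cycle changes the position by 1 or -1 modulo n.
\<close>

lemma cycle_walk_offset:
  assumes "ug_walk (cycle_ugraph n) u p v"
  shows "\<exists>d. \<bar>d\<bar> \<le> int (length p - 1) \<and> int n dvd int v - int u - d"
  using assms
proof (induction p arbitrary: u)
  case (Cons a p)
  show ?case
  proof (cases p)
    case Nil
    then show ?thesis using Cons.prems by (auto simp: ug_walk_def)
  next
    case (Cons b q)
    then have a: "a = u" and ab: "{u, b} \<in> ug_edges (cycle_ugraph n)"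
      and w: "ug_walk (cycle_ugraph n) b p v"
      using Cons.prems by (auto simp: ug_walk_def)
    obtain d where d: "\<bar>d\<bar> \<le> 1" "int n dvd int b - int u - d"
      using cycle_edge_cases[OF ab] by blast
    obtain e where e: "\<bar>e\<bar> \<le> int (length p - 1)" "int n dvd int v - int b - e"
      using Cons.IH[OF w] by blast
    have "int n dvd (int b - int u - d) + (int v - int b - e)"
      using d(2) e(2) by (rule dvd_add)
    then have "int n dvd int v - int u - (d + e)"
      by (simp add: algebra_simps)
    moreover have "\<bar>d + e\<bar> \<le> int (length (a # p) - 1)"
      using d(1) e(1) Cons by simp
    ultimately show ?thesis by blast
  qed
qed (simp add: ug_walk_def)

lemma cycle_walk_exists:
  assumes "u < n"
  shows "\<exists>p. ug_walk (cycle_ugraph n) u p ((u + d) mod n) \<and> length p = Suc d"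
proof (induction d)
  case 0
  show ?case
    using assms by (intro exI[of _ "[u]"]) (simp add: ug_walk_def cycle_ugraph_def)
next
  case (Suc d)
  then obtain p where p: "ug_walk (cycle_ugraph n) u p ((u + d) mod n)" "length p = Suc d" by blast
  have "{(u + d) mod n, ((u + d) mod n + 1) mod n} \<in> ug_edges (cycle_ugraph n)"
    using assms by (auto simp: cycle_ugraph_def)
  moreover have "((u + d) mod n + 1) mod n = (u + Suc d) mod n"
    by (simp add: mod_simps)
  ultimately have "ug_walk (cycle_ugraph n) ((u + d) mod n) [(u + d) mod n, (u + Suc d) mod n] ((u + Suc d) mod n)"
    using assms by (simp add: ug_walk_def cycle_ugraph_def)
  from ug_walk_append[OF p(1) this] p(2) show ?case
    by (intro exI[of _ "p @ [(u + Suc d) mod n]"]) simp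
qed

lemma cycle_power_edge_iff:
  assumes n: "u < n" "v < n"
  shows "{u, v} \<in> ug_edges (ug_power (cycle_ugraph n) k) \<longleftrightarrow>
    u \<noteq> v \<and> (\<exists>d. \<bar>d\<bar> \<le> int k \<and> int n dvd int v - int u - d)"
proof -
  define R where "R u v \<longleftrightarrow> (\<exists>d. \<bar>d\<bar> \<le> int k \<and> int n dvd int v - int u - d)" for u v
  have sym: "R v u" if "R u v" for u v
  proof -
    from that obtain d where d: "\<bar>d\<bar> \<le> int k" "int n dvd int v - int u - d"
      unfolding R_def by blast
    have "int n dvd - (int v - int u - d)" using d(2) by (simp only: dvd_minus_iff)
    then have "int n dvd int u - int v - (- d)" by (simp add: algebra_simps)
    with d(1) show ?thesis unfolding R_def by (intro exI[of _ "- d"]) simp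
  qed
  have dist: "ug_dist (cycle_ugraph n) u v \<le> enat k \<longleftrightarrow> R u v" if n: "u < n" "v < n" for u v
  proof
    assume "ug_dist (cycle_ugraph n) u v \<le> enat k"
    then obtain p where p: "ug_walk (cycle_ugraph n) u p v" "length p - 1 \<le> k"
      unfolding ug_dist_le_iff by blast
    then obtain d where "\<bar>d\<bar> \<le> int (length p - 1)" "int n dvd int v - int u - d"
      using cycle_walk_offset by blast
    with p(2) show "R u v" unfolding R_def by (intro exI[of _ d]) simp
  next
    assume "R u v"
    have pos: "\<exists>p. ug_walk (cycle_ugraph n) u p v \<and> length p - 1 \<le> k"
      if "u < n" "v < n" "0 \<le> d" "\<bar>d\<bar> \<le> int k" "int n dvd int v - int u - d" for u v d
    proof -
      have "int v mod int n = (int u + d) mod int n"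
        using that(5) by (simp add: mod_eq_dvd_iff algebra_simps)
      then have "int v = int ((u + nat d) mod n)"
        using that by (simp add: zmod_int)
      then show ?thesis
        using cycle_walk_exists[OF that(1), of "nat d"] that by auto
    qed
    obtain d where d: "\<bar>d\<bar> \<le> int k" "int n dvd int v - int u - d"
      using \<open>R u v\<close> by (auto simp: R_def)
    show "ug_dist (cycle_ugraph n) u v \<le> enat k"
      unfolding ug_dist_le_iff
    proof (cases "0 \<le> d")
      case True
      then show "\<exists>p. ug_walk (cycle_ugraph n) u p v \<and> length p - 1 \<le> k"
        using pos[OF n True d] by simp
    next
      case False
      have "int n dvd - (int v - int u - d)" using d(2) by (simp only: dvd_minus_iff)
      then have "int n dvd int u - int v - (- d)" by (simp add: algebra_simps)
      then obtain p where "ug_walk (cycle_ugraph n) v p u" "length p - 1 \<le> k"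
        using pos[OF n(2,1), of "- d"] False d(1) by auto
      then show "\<exists>p. ug_walk (cycle_ugraph n) u p v \<and> length p - 1 \<le> k"
        by (intro exI[of _ "rev p"]) (simp add: ug_walk_rev)
    qed
  qed
  have V: "x \<in> ug_verts (cycle_ugraph n) \<longleftrightarrow> x < n" for x
    by (simp add: cycle_ugraph_def)
  have "{u, v} \<in> ug_edges (ug_power (cycle_ugraph n) k) \<longleftrightarrow>
      (\<exists>x y. {u, v} = {x, y} \<and> x < n \<and> y < n \<and> x \<noteq> y \<and> R x y)"
    unfolding ug_power_def snd_conv mem_Collect_eq V
    using dist ug_dist_ge_1_iff[of _ "cycle_ugraph n"] V by metis
  also have "\<dots> \<longleftrightarrow> u \<noteq> v \<and> R u v"
    using n sym by (auto simp: doubleton_eq_iff)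
  finally show ?thesis unfolding R_def .
qed

section \<open>The total number of leaves as a determinant\<close>

text \<open>
  Once a vertex v of the cycle on \<open>n = N + 1\<close> vertices is removed, the vertex \<open>v + 1 + i\<close> gets the number
  \<open>i < N\<close>; \<open>near N i\<close> are the numbers of its remaining neighbours in the fourth power.
\<close>

definition near :: "nat \<Rightarrow> nat \<Rightarrow> nat set" where
  "near N i = {j. j < N \<and> j \<noteq> i \<and> ((i \<le> j + 4 \<and> j \<le> i + 4) \<or> i + N \<le> j + 3 \<or> j + N \<le> i + 3)}"

text \<open>
  The Laplacian matrix of the graph without v, with row 0 replaced by a unit vector: number 0 is the
  root.
\<close>

definition leaf_mat :: "nat \<Rightarrow> 'a :: comm_ring_1 mat" where
  "leaf_mat N = mat N N (\<lambda>(i, k). if i = 0 then (if k = 0 then 1 else 0)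
     else (if k = i then of_nat (card (near N i)) else 0) - (if k \<in> near N i then 1 else 0))"

lemma add_mod_eq_iff:
  assumes "i < n" "j < n"
  shows "(v + i) mod n = (v + j) mod (n :: nat) \<longleftrightarrow> i = j"
proof -
  have "i = j" if ij: "i \<le> j" "j < n" "(v + j) mod n = (v + i) mod n" for i j
  proof -
    have "n dvd (v + j) - (v + i)"
      using ij mod_eq_dvd_iff_nat[of "v + i" "v + j" n] by simp
    then have "n dvd j - i" by simp
    with ij(1,2) show ?thesis by (metis diff_is_0_eq dvd_imp_le le_antisym less_imp_diff_less not_less zero_less_iff_neq_zero)
  qed
  from this[of i j] this[of j i] assms show ?thesis by (metis nat_le_linear)
qed

lemma shifted_edge_iff:
  assumes "i < n" "j < n"
  shows "{(v + i) mod n, (v + j) mod n} \<in> ug_edges (ug_power (cycle_ugraph n) 4) \<longleftrightarrow>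
    i \<noteq> j \<and> ((i \<le> j + 4 \<and> j \<le> i + 4) \<or> i + n \<le> j + 4 \<or> j + n \<le> i + 4)"
proof -
  have inj: "(v + i) mod n = (v + j) mod n \<longleftrightarrow> i = j"
    by (rule add_mod_eq_iff[OF assms])
  have "int n dvd int ((v + j) mod n) - int ((v + i) mod n) - d \<longleftrightarrow> int n dvd int j - int i - d" for d
    unfolding mod_eq_dvd_iff[symmetric] diff_diff_eq zmod_int
    by (simp add: mod_simps) (simp add: mod_eq_dvd_iff algebra_simps)
  moreover have "(\<exists>d. \<bar>d\<bar> \<le> 4 \<and> int n dvd int j - int i - d) \<longleftrightarrow>
      (i \<le> j + 4 \<and> j \<le> i + 4) \<or> i + n \<le> j + 4 \<or> j + n \<le> i + 4"
  proof
    assume "\<exists>d. \<bar>d\<bar> \<le> 4 \<and> int n dvd int j - int i - d"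
    then obtain d q where d: "\<bar>d\<bar> \<le> 4" and q: "int j - int i - d = int n * q"
      by (auto simp: dvd_def)
    consider "q = 0" | "1 \<le> q" | "q \<le> -1" by linarith
    then show "(i \<le> j + 4 \<and> j \<le> i + 4) \<or> i + n \<le> j + 4 \<or> j + n \<le> i + 4"
    proof cases
      case 2
      then have "int n * 1 \<le> int n * q" by (intro mult_left_mono) auto
      with q d show ?thesis by linarith
    next
      case 3
      then have "int n * q \<le> int n * (-1)" by (intro mult_left_mono) auto
      with q d show ?thesis by linarith
    qed (use q d in simp, linarith)
  next
    assume "(i \<le> j + 4 \<and> j \<le> i + 4) \<or> i + n \<le> j + 4 \<or> j + n \<le> i + 4"
    then consider "\<bar>int j - int i\<bar> \<le> 4" | "i + n \<le> j + 4" | "j + n \<le> i + 4" by linarith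
    then show "\<exists>d. \<bar>d\<bar> \<le> 4 \<and> int n dvd int j - int i - d"
    proof cases
      case 1
      then show ?thesis by (intro exI[of _ "int j - int i"]) simp
    next
      case 2
      then show ?thesis using assms by (intro exI[of _ "int j - int i - int n"]) auto
    next
      case 3
      then show ?thesis using assms by (intro exI[of _ "int j - int i + int n"]) auto
    qed
  qed
  ultimately show ?thesis
    using assms by (subst cycle_power_edge_iff) (simp_all add: inj)
qed

theorem total_leaves_eq_det:
  assumes n: "9 \<le> n"
  shows "of_nat (ug_total_leaves (ug_power (cycle_ugraph n) 4)) =
    (of_nat (8 * n) * det (leaf_mat (n - 1)) :: 'a :: idom)"
proof -
  let ?G = "ug_power (cycle_ugraph n) 4"
  define N where "N = n - 1"
  have V: "ug_verts ?G = {0..<n}"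
    by (simp add: ug_power_def cycle_ugraph_def)
  have G: "ug_simple ?G"
    by (rule ug_simple_power) (simp add: cycle_ugraph_def)
  have leaf: "of_nat (card {T \<in> ug_spanning_trees ?G. v \<in> ug_leaves T}) = 8 * (det (leaf_mat N) :: 'a)"
    if v: "v < n" for v
  proof -
    define s where "s i = (v + Suc i) mod n" for i
    have s0: "(v + 0) mod n = v" using v by simp
    have inj: "inj_on (\<lambda>i. (v + i) mod n) {0..<n}"
      by (rule inj_onI) (simp add: add_mod_eq_iff)
    have "(\<lambda>i. (v + i) mod n) ` {0..<n} = {0..<n}"
      using v by (intro endo_inj_surj inj) auto
    with inj have bij: "bij_betw (\<lambda>i. (v + i) mod n) {0..<n} {0..<n}"
      by (simp add: bij_betw_def)
    have "bij_betw (\<lambda>i. (v + i) mod n) ({0..<n} - {0}) ({0..<n} - {v})"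
      using bij_betw_DiffI[OF bij, of "{0}" "{v}"] v s0 by (simp add: bij_betw_def)
    moreover have "bij_betw Suc {0..<N} ({0..<n} - {0})"
      using n by (intro bij_betwI[of _ _ _ "\<lambda>i. i - 1"]) (auto simp: N_def)
    ultimately have bs: "bij_betw s {0..<N} (ug_verts ?G - {v})"
      using bij_betw_trans[of Suc _ _ "\<lambda>i. (v + i) mod n"] by (simp add: V s_def[abs_def] o_def)
    have nbs: "{j. j < N \<and> {s i, s j} \<in> ug_edges ?G} = near N i" if "i < N" for i
      using that n unfolding near_def s_def
      by (intro Collect_cong conj_cong refl, subst shifted_edge_iff) (auto simp: N_def)
    have nb_bij: "bij_betw (\<lambda>i. (v + i) mod n) {i \<in> {0..<n}. {v, (v + i) mod n} \<in> ug_edges ?G}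
        {w \<in> {0..<n}. {v, w} \<in> ug_edges ?G}"
      by (rule bij_betw_Collect[OF bij]) simp
    have nb_idx: "{i \<in> {0..<n}. {v, (v + i) mod n} \<in> ug_edges ?G} = {1..<5} \<union> {n - 4..<n}"
    proof -
      have "{v, (v + i) mod n} \<in> ug_edges ?G \<longleftrightarrow> i \<noteq> 0 \<and> (i \<le> 4 \<or> n \<le> i + 4)" if "i < n" for i
        using shifted_edge_iff[of 0 n i v] that n v by auto
      then have "{i \<in> {0..<n}. {v, (v + i) mod n} \<in> ug_edges ?G} = {i. i < n \<and> i \<noteq> 0 \<and> (i \<le> 4 \<or> n \<le> i + 4)}"
        by auto
      also have "\<dots> = {1..<5} \<union> {n - 4..<n}" using n by auto
      finally show ?thesis .
    qed
    have nb_card: "card ({1..<5} \<union> {n - 4..<n}) = 8"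
      using n by (subst card_Un_disjoint) auto
    have nb_all: "{w \<in> {0..<n}. {v, w} \<in> ug_edges ?G} = {w. {v, w} \<in> ug_edges ?G}"
      using G V by (auto simp: ug_simple_def)
    have deg: "card {w. {v, w} \<in> ug_edges ?G} = 8"
      using bij_betw_same_card[OF nb_bij] unfolding nb_idx nb_card nb_all by (rule sym)
    have "(\<Sum>j \<in> (if i = 0 then {0} else {j. j < N \<and> {s i, s j} \<in> ug_edges ?G}). hop i j k) =
        (if i = 0 then if k = 0 then 1 else 0 else
          (if k = i then of_nat (card (near N i)) else 0) - (if k \<in> near N i then 1 else 0) :: 'a)"
      if "i < N" for i k
    proof (cases "i = 0")
      case False
      have "(\<Sum>j \<in> near N i. hop i j k) = (\<Sum>j \<in> near N i. (if k = i then 1 else 0 :: 'a) - (if k = j then 1 else 0))"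
        by (rule sum.cong) (auto simp: hop_def near_def)
      then show ?thesis
        using False nbs[OF that] by (auto simp: sum_subtractf near_def)
    qed (auto simp: hop_def)
    then have "mat N N (\<lambda>(i, k). \<Sum>j \<in> (if i = 0 then {0} else {j. j < N \<and> {s i, s j} \<in> ug_edges ?G}).
        hop i j k) = (leaf_mat N :: 'a mat)"
      unfolding leaf_mat_def by (intro eq_matI) auto
    then show ?thesis
      using card_spanning_trees_leaf[OF G _ bs, of 0, where ?'b = 'a] v n
      by (simp add: V deg N_def)
  qed
  have fin: "finite (ug_spanning_trees ?G)"
    by (rule finite_ug_spanning_trees[OF G])
  have "ug_total_leaves ?G = (\<Sum>T \<in> ug_spanning_trees ?G. \<Sum>v \<in> {0..<n}. if v \<in> ug_leaves T then 1 else 0)"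
    unfolding ug_total_leaves_def
  proof (rule sum.cong)
    fix T assume T: "T \<in> ug_spanning_trees ?G"
    then have "ug_leaves T = {v \<in> {0..<n}. v \<in> ug_leaves T}"
      using V by (auto simp: ug_leaves_def ug_spanning_trees_def)
    then show "card (ug_leaves T) = (\<Sum>v \<in> {0..<n}. if v \<in> ug_leaves T then 1 else 0)"
      using sum.inter_filter[of "{0..<n}" "\<lambda>_. 1 :: nat" "\<lambda>v. v \<in> ug_leaves T"] by simp
  qed simp
  also have "\<dots> = (\<Sum>v \<in> {0..<n}. \<Sum>T \<in> ug_spanning_trees ?G. if v \<in> ug_leaves T then 1 else 0)"
    by (rule sum.swap)
  also have "\<dots> = (\<Sum>v \<in> {0..<n}. card {T \<in> ug_spanning_trees ?G. v \<in> ug_leaves T})"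
    using sum.inter_filter[OF fin, of "\<lambda>_. 1 :: nat"] by simp
  finally have "of_nat (ug_total_leaves ?G) = (\<Sum>v \<in> {0..<n}. 8 * (det (leaf_mat N) :: 'a))"
    using leaf by simp
  then show ?thesis by (simp add: N_def mult_ac)
qed

section \<open>Reduction of the banded determinant to size eight\<close>

lemma leaf_mat_row_sum:
  assumes "i < N" "i \<noteq> 0"
  shows "(\<Sum>j=0..<N. leaf_mat N $$ (i, j) * x j) =
    of_nat (card (near N i)) * x i - (\<Sum>j\<in>near N i. x j :: 'a :: comm_ring_1)"
proof -
  have sub: "near N i \<subseteq> {0..<N}" by (auto simp: near_def)
  have "(\<Sum>j=0..<N. leaf_mat N $$ (i, j) * x j) =
      (\<Sum>j=0..<N. (if j = i then of_nat (card (near N i)) * x i else 0) - (if j \<in> near N i then x j else 0))"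
    using assms by (intro sum.cong) (auto simp: leaf_mat_def near_def)
  also have "\<dots> = of_nat (card (near N i)) * x i - (\<Sum>j\<in>{0..<N} \<inter> near N i. x j)"
    using assms by (simp add: sum_subtractf sum.inter_restrict)
  finally show ?thesis using sub by (simp add: Int_absorb1)
qed

text \<open>
  The eight boundary rows, in the cyclic order \<open>N - 4, ..., N - 1, 0, ..., 3\<close>, where \<open>N = m + 8\<close>: the
  coefficient of row \<open>k\<close> at column \<open>s\<close> is \<open>head_coeff k s\<close> and at column \<open>m + s\<close> it is
  \<open>tail_coeff k s\<close>, to be added where the two ranges of columns overlap. No other columns occur.
\<close>

definition head_coeff :: "nat \<Rightarrow> nat \<Rightarrow> 'a :: comm_ring_1" where
  "head_coeff k s =
     (if k < 4 then (if s < k then - 1 else 0)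
      else if k = 4 then (if s = 0 then 1 else 0)
      else (if s = k - 4 then 7 else if s \<le> k then - 1 else 0))"

definition tail_coeff :: "nat \<Rightarrow> nat \<Rightarrow> 'a :: comm_ring_1" where
  "tail_coeff k s =
     (if k < 4 then (if s = k + 4 then 7 else if k \<le> s then - 1 else 0)
      else if k = 4 then 0
      else (if k < s then - 1 else 0))"

definition boundary_mat :: "(nat \<Rightarrow> nat \<Rightarrow> 'a :: comm_ring_1) \<Rightarrow> nat \<Rightarrow> 'a mat" where
  "boundary_mat \<phi> m = mat 8 8 (\<lambda>(k, c). \<Sum>s<8. head_coeff k s * \<phi> c s + tail_coeff k s * \<phi> c (m + s))"

definition start_mat :: "(nat \<Rightarrow> nat \<Rightarrow> 'a :: comm_ring_1) \<Rightarrow> 'a mat" where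
  "start_mat \<phi> = mat 8 8 (\<lambda>(s, c). \<phi> c s)"

lemma near_low:
  "near (m + 8) 1 = {0, 2, 3, 4, 5, m + 6, m + 7}"
  "near (m + 8) 2 = {0, 1, 3, 4, 5, 6, m + 7}"
  "near (m + 8) 3 = {0, 1, 2, 4, 5, 6, 7}"
  by (auto simp: near_def)

lemma near_high:
  "near (m + 8) (m + 4) = {m, m + 1, m + 2, m + 3, m + 5, m + 6, m + 7}"
  "near (m + 8) (m + 5) = {0, m + 1, m + 2, m + 3, m + 4, m + 6, m + 7}"
  "near (m + 8) (m + 6) = {0, 1, m + 2, m + 3, m + 4, m + 5, m + 7}"
  "near (m + 8) (m + 7) = {0, 1, 2, m + 3, m + 4, m + 5, m + 6}"
  by (auto simp: near_def)

lemma near_mid: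
  assumes "a < m"
  shows "near (m + 8) (a + 4) = {a, a + 1, a + 2, a + 3, a + 5, a + 6, a + 7, a + 8}"
  using assms by (auto simp: near_def)

lemma boundary_row:
  assumes "k < 8"
  shows "(\<Sum>j=0..<m + 8. leaf_mat (m + 8) $$ ((k + m + 4) mod (m + 8), j) * x j) =
    (\<Sum>s<8. head_coeff k s * x s + tail_coeff k s * x (m + s) :: 'a :: comm_ring_1)"
proof -
  have s8: "{..<8::nat} = {0, 1, 2, 3, 4, 5, 6, 7}" by auto
  consider "k = 0" | "k = 1" | "k = 2" | "k = 3" | "k = 4" | "k = 5" | "k = 6" | "k = 7"
    using assms by linarith
  then show ?thesis
  proof cases
    case 1
    then show ?thesis
      by (simp add: leaf_mat_row_sum near_high add.commute[of _ m]) (simp add: s8 head_coeff_def tail_coeff_def)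
  next
    case 2
    then show ?thesis
      by (simp add: leaf_mat_row_sum near_high add.commute[of _ m]) (simp add: s8 head_coeff_def tail_coeff_def)
  next
    case 3
    then show ?thesis
      by (simp add: leaf_mat_row_sum near_high add.commute[of _ m]) (simp add: s8 head_coeff_def tail_coeff_def)
  next
    case 4
    then show ?thesis
      by (simp add: leaf_mat_row_sum near_high add.commute[of _ m]) (simp add: s8 head_coeff_def tail_coeff_def)
  next
    case 5
    have "(\<Sum>j=0..<m + 8. leaf_mat (m + 8) $$ (0, j) * x j) = (\<Sum>j=0..<m + 8. if j = 0 then x 0 else 0)"
      by (intro sum.cong) (auto simp: leaf_mat_def)
    moreover have "(k + m + 4) mod (m + 8) = 0" using 5 by (simp add: add.commute)
    ultimately show ?thesis
      using 5 by (simp add: s8 head_coeff_def tail_coeff_def)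
  next
    case 6
    have "(k + m + 4) mod (m + 8) = 1" using 6 by (simp add: mod_if)
    then show ?thesis
      using 6 by (simp add: leaf_mat_row_sum near_low[simplified]) (simp add: s8 head_coeff_def tail_coeff_def)
  next
    case 7
    have "(k + m + 4) mod (m + 8) = 2" using 7 by (simp add: mod_if)
    then show ?thesis
      using 7 by (simp add: leaf_mat_row_sum near_low[simplified]) (simp add: s8 head_coeff_def tail_coeff_def)
  next
    case 8
    have "(k + m + 4) mod (m + 8) = 3" using 8 by (simp add: mod_if)
    then show ?thesis
      using 8 by (simp add: leaf_mat_row_sum near_low[simplified]) (simp add: s8 head_coeff_def tail_coeff_def)
  qed
qed

text \<open>
  A cyclic shift by 4 is a fourth power, hence an even permutation for every size.
\<close>

lemma det_rotate_rows:
  fixes A :: "'a :: comm_ring_1 mat"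
  assumes A: "A \<in> carrier_mat n n" and n: "0 < n"
  shows "det (mat n n (\<lambda>(i, j). A $$ ((i + 4) mod n, j))) = det A"
proof -
  define q where "q k = (if k < n then (k + 1) mod n else k)" for k
  have "bij_betw q {0..<n} {0..<n}"
  proof -
    have "inj_on q {0..<n}"
      using add_mod_eq_iff[of _ n _ 1] by (auto simp: inj_on_def q_def)
    moreover have "q ` {0..<n} = {0..<n}"
      by (intro endo_inj_surj calculation) (auto simp: q_def n)
    ultimately show ?thesis by (simp add: bij_betw_def)
  qed
  then have q: "q permutes {0..<n}"
    by (intro bij_imp_permutes) (auto simp: q_def)
  then have q2: "q \<circ> q permutes {0..<n}" by (intro permutes_compose)
  have q4: "(q \<circ> q) \<circ> (q \<circ> q) permutes {0..<n}" using q2 q2 by (rule permutes_compose)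
  have perm: "permutation q" "permutation (q \<circ> q)"
    using q q2 finite_atLeastLessThan permutation_permutes by blast+
  have "sign ((q \<circ> q) \<circ> (q \<circ> q)) = (sign q * sign q) * (sign q * sign q)"
    using perm by (simp add: sign_compose)
  then have sgn: "sign ((q \<circ> q) \<circ> (q \<circ> q)) = 1"
    by (simp add: sign_def)
  have q4_eq: "((q \<circ> q) \<circ> (q \<circ> q)) i = (i + 4) mod n" if "i < n" for i
    using that by (simp add: q_def mod_simps eval_nat_numeral)
  have "det (mat n n (\<lambda>(i, j). A $$ (((q \<circ> q) \<circ> (q \<circ> q)) i, j))) = det A"
    using det_permute_rows[OF A q4] sgn by simp
  moreover have "mat n n (\<lambda>(i, j). A $$ (((q \<circ> q) \<circ> (q \<circ> q)) i, j)) = mat n n (\<lambda>(i, j). A $$ ((i + 4) mod n, j))"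
    using q4_eq by (intro eq_matI) (simp_all del: o_apply)
  ultimately show ?thesis by simp
qed

text \<open>
  Shifting the rows cyclically by 4 puts the boundary rows on top and makes -1, the coefficient at the
  last neighbour, the diagonal entry of every interior row. Multiplication from the right by the
  matrix with columns \<open>\<phi> 0, ..., \<phi> 7\<close> followed by unit vectors then clears the first eight columns of
  the interior rows, since \<open>\<phi>\<close> solves the interior equations; what remains there is triangular.
\<close>

theorem det_leaf_mat_reduction:
  fixes \<phi> :: "nat \<Rightarrow> nat \<Rightarrow> 'a :: idom"
  assumes rec: "\<And>c j. c < 8 \<Longrightarrow> 8 * \<phi> c (j + 4) =
    \<phi> c j + \<phi> c (j + 1) + \<phi> c (j + 2) + \<phi> c (j + 3) + \<phi> c (j + 5) + \<phi> c (j + 6) + \<phi> c (j + 7) + \<phi> c (j + 8)"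
  shows "det (leaf_mat (m + 8)) * det (start_mat \<phi>) = (-1) ^ m * det (boundary_mat \<phi> m)"
proof -
  let ?N = "m + 8"
  define R where "R = mat ?N ?N (\<lambda>(k, j). leaf_mat ?N $$ ((k + m + 4) mod ?N, j) :: 'a)"
  define U where "U = mat ?N ?N (\<lambda>(j, c). if c < 8 then \<phi> c j else if j = c then 1 else 0)"
  have Rc: "R \<in> carrier_mat ?N ?N" and Uc: "U \<in> carrier_mat ?N ?N"
    by (simp_all add: R_def U_def)
  have "det (mat ?N ?N (\<lambda>(i, j). R $$ ((i + 4) mod ?N, j))) = det R"
    by (rule det_rotate_rows[OF Rc]) simp
  moreover have "mat ?N ?N (\<lambda>(i, j). R $$ ((i + 4) mod ?N, j)) = leaf_mat ?N"
  proof (rule eq_matI)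
    fix i j assume "i < dim_row (leaf_mat ?N :: 'a mat)" "j < dim_col (leaf_mat ?N :: 'a mat)"
    then have ij: "i < ?N" "j < ?N" by (simp_all add: leaf_mat_def)
    have "((i + 4) mod ?N + m + 4) mod ?N = (i + ?N) mod ?N"
      by (simp only: add.assoc mod_add_left_eq) (simp add: algebra_simps)
    then have "((i + 4) mod ?N + m + 4) mod ?N = i" using ij by simp
    with ij show "mat ?N ?N (\<lambda>(i, j). R $$ ((i + 4) mod ?N, j)) $$ (i, j) = leaf_mat ?N $$ (i, j)"
      by (simp add: R_def)
  qed (simp_all add: leaf_mat_def)
  ultimately have detR: "det R = det (leaf_mat ?N)" by simp
  have "U = four_block_mat (start_mat \<phi>) (0\<^sub>m 8 m) (mat m 8 (\<lambda>(j, c). \<phi> c (j + 8))) (1\<^sub>m m)"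
    by (rule eq_matI) (auto simp: U_def start_mat_def)
  then have detU: "det U = det (start_mat \<phi>)"
    by (simp add: det_four_block_mat_upper_right_zero[of _ 8 _ m] start_mat_def)
  define D where "D = mat m m (\<lambda>(a, b). leaf_mat ?N $$ (a + 4, b + 8) :: 'a)"
  define X where "X = mat 8 m (\<lambda>(k, b). R $$ (k, b + 8))"
  have "R * U = four_block_mat (boundary_mat \<phi> m) X (0\<^sub>m m 8) D"
  proof (rule eq_matI)
    fix k c assume "k < dim_row (four_block_mat (boundary_mat \<phi> m) X (0\<^sub>m m 8) D)"
      and "c < dim_col (four_block_mat (boundary_mat \<phi> m) X (0\<^sub>m m 8) D)"
    then have k: "k < ?N" and c: "c < ?N"
      by (simp_all add: boundary_mat_def D_def)
    have RU: "(R * U) $$ (k, c) = (\<Sum>j=0..<?N. R $$ (k, j) * U $$ (j, c))"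
      using k c by (simp add: R_def U_def scalar_prod_def)
    show "(R * U) $$ (k, c) = four_block_mat (boundary_mat \<phi> m) X (0\<^sub>m m 8) D $$ (k, c)"
    proof (cases "c < 8")
      case True
      have "(R * U) $$ (k, c) = (\<Sum>j=0..<?N. leaf_mat ?N $$ ((k + m + 4) mod ?N, j) * \<phi> c j)"
        unfolding RU using k True by (intro sum.cong) (auto simp: R_def U_def)
      also have "\<dots> = four_block_mat (boundary_mat \<phi> m) X (0\<^sub>m m 8) D $$ (k, c)"
      proof (cases "k < 8")
        case k8: True
        then show ?thesis
          using True k by (simp add: boundary_row[OF k8] boundary_mat_def D_def)
      next
        case False
        define a where "a = k - 8"
        have a: "k = a + 8" "a < m" using k False by (auto simp: a_def)
        have "(k + m + 4) mod ?N = a + 4"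
          using a by (simp add: mod_if)
        moreover have "(\<Sum>j=0..<?N. leaf_mat ?N $$ (a + 4, j) * \<phi> c j) = 0"
          using a rec[OF True, of a] by (simp add: leaf_mat_row_sum near_mid)
        ultimately show ?thesis
          using True a by (simp add: boundary_mat_def D_def)
      qed
      finally show ?thesis .
    next
      case False
      have "(R * U) $$ (k, c) = (\<Sum>j=0..<?N. if j = c then R $$ (k, c) else 0)"
        unfolding RU using False c by (intro sum.cong) (auto simp: U_def)
      then have "(R * U) $$ (k, c) = R $$ (k, c)" using c by simp
      moreover have "R $$ (k, c) = leaf_mat ?N $$ (k - 8 + 4, c)" if "8 \<le> k"
      proof -
        have "(k + m + 4) mod ?N = k - 8 + 4" using that k by (simp add: mod_if)
        then show ?thesis using k c by (simp add: R_def)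
      qed
      ultimately show ?thesis
        using False k c by (auto simp: boundary_mat_def X_def D_def)
    qed
  qed (simp_all add: R_def U_def boundary_mat_def D_def)
  then have "det (R * U) = det (boundary_mat \<phi> m) * det D"
    by (simp add: det_four_block_mat_lower_left_zero[of _ 8 _ m] boundary_mat_def X_def D_def)
  moreover have "det D = (-1) ^ m"
  proof -
    have "D $$ (a, b) = 0" if "a < b" "b < m" for a b
      using that near_mid[of a m] by (simp add: D_def leaf_mat_def)
    moreover have "D $$ (a, a) = - 1" if "a < m" for a
      using that near_mid[of a m] by (simp add: D_def leaf_mat_def)
    ultimately show ?thesis
      by (subst det_lower_triangular[of m]) (auto simp: D_def prod_list_diag_prod)
  qed
  ultimately show ?thesis
    using det_mult[OF Rc Uc] detR detU by simp
qed

section \<open>Linear recurrences on the integers\<close>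

text \<open>
  The polynomial p acts on two-sided sequences with its variable read as the backward shift. Two-sided
  sequences are used because the value at -1 will decide the degree of the numerator.
\<close>

definition shift_op :: "'a :: comm_ring_1 poly \<Rightarrow> (int \<Rightarrow> 'a) \<Rightarrow> int \<Rightarrow> 'a" where
  "shift_op p h n = (\<Sum>i\<le>degree p. coeff p i * h (n - int i))"

lemma shift_op_altdef:
  assumes "degree p \<le> D"
  shows "shift_op p h n = (\<Sum>i\<le>D. coeff p i * h (n - int i))"
  unfolding shift_op_def
  by (rule sum.mono_neutral_left) (use assms in \<open>auto simp: coeff_eq_0\<close>)

lemma shift_op_0 [simp]: "shift_op 0 h n = 0"
  by (simp add: shift_op_def)

lemma shift_op_pCons: "shift_op (pCons a p) h n = a * h n + shift_op p h (n - 1)"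
proof -
  have "shift_op (pCons a p) h n = (\<Sum>i\<le>Suc (degree p). coeff (pCons a p) i * h (n - int i))"
    by (rule shift_op_altdef) (simp add: degree_pCons_le)
  also have "\<dots> = a * h n + (\<Sum>i\<le>degree p. coeff p i * h (n - 1 - int i))"
    by (subst sum.atMost_Suc_shift) (simp add: algebra_simps)
  finally show ?thesis by (simp add: shift_op_def)
qed

lemma shift_op_add: "shift_op (p + q) h n = shift_op p h n + shift_op q h n"
  using degree_add_le_max[of p q]
  by (simp add: shift_op_altdef[of _ "max (degree p) (degree q)"] algebra_simps sum.distrib)

lemma shift_op_smult: "shift_op (Polynomial.smult a p) h n = a * shift_op p h n"
  using Polynomial.degree_smult_le[of a p]
  by (simp add: shift_op_altdef[of _ "degree p"] sum_distrib_left mult_ac)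

lemma shift_op_mult: "shift_op (p * q) h = shift_op p (shift_op q h)"
proof
  fix n show "shift_op (p * q) h n = shift_op p (shift_op q h) n"
    by (induction p arbitrary: n)
      (simp_all add: mult_pCons_left shift_op_add shift_op_smult shift_op_pCons)
qed

lemma shift_op_sum: "shift_op p (\<lambda>n. \<Sum>x\<in>X. h x n) n = (\<Sum>x\<in>X. shift_op p (h x) n)"
  unfolding shift_op_def sum_distrib_left by (rule sum.swap)

lemma shift_op_scale: "shift_op p (\<lambda>n. c * h n) n = c * shift_op p h n"
  by (simp add: shift_op_def sum_distrib_left mult_ac)

lemma shift_op_const_0: "shift_op p (\<lambda>n. 0) n = 0"
  by (simp add: shift_op_def)

text \<open>
  Each factor \<open>1 - l t\<close> lowers by one the degree of the polynomial in front of \<open>l^n\<close>.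
\<close>

lemma shift_op_quadratic_exponential:
  fixes l :: "'a :: field"
  assumes l: "l \<noteq> 0" and dvd: "[:1, - l:] ^ 3 dvd p"
  shows "shift_op p (\<lambda>n. (a + of_int n * b + of_int n ^ 2 * c) * l powi n) n = 0"
proof -
  define L where "L = [:1, - l:]"
  obtain q where q: "p = q * L ^ 3"
    using dvd unfolding L_def by (metis dvdE mult.commute)
  have L: "shift_op L h n = h n - l * h (n - 1)" for h n
    by (simp add: L_def shift_op_pCons)
  have pw: "l * l powi (n - 1) = l powi n" for n
    using l by (simp add: power_int_diff)
  have step: "shift_op L (\<lambda>n. (a + of_int n * b + of_int n ^ 2 * c) * l powi n) =
      (\<lambda>n. ((b - c) + of_int n * (2 * c) + of_int n ^ 2 * 0) * l powi n)" for a b c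
  proof
    fix n
    have "shift_op L (\<lambda>n. (a + of_int n * b + of_int n ^ 2 * c) * l powi n) n =
        (a + of_int n * b + of_int n ^ 2 * c) * l powi n -
        (a + of_int (n - 1) * b + of_int (n - 1) ^ 2 * c) * (l * l powi (n - 1))"
      by (simp add: L algebra_simps)
    also have "\<dots> = ((b - c) + of_int n * (2 * c) + of_int n ^ 2 * 0) * l powi n"
      unfolding pw by (simp add: algebra_simps power2_eq_square)
    finally show "shift_op L (\<lambda>n. (a + of_int n * b + of_int n ^ 2 * c) * l powi n) n = \<dots>" .
  qed
  have "shift_op (L ^ 3) (\<lambda>n. (a + of_int n * b + of_int n ^ 2 * c) * l powi n) =
      shift_op L (shift_op L (shift_op L (\<lambda>n. (a + of_int n * b + of_int n ^ 2 * c) * l powi n)))"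
    by (simp only: power3_eq_cube shift_op_mult)
  also have "\<dots> = (\<lambda>n. 0)"
    unfolding step by simp
  finally show ?thesis
    unfolding q shift_op_mult by (simp add: shift_op_const_0)
qed

lemma power_int_prod: "(\<Prod>x\<in>X. f x :: 'a :: field) powi n = (\<Prod>x\<in>X. f x powi n)"
  by (induction X rule: infinite_finite_induct) (simp_all add: power_int_mult_distrib)

text \<open>
  Multiplying out the product over A gives one exponential for each subset of A. The factor of degree
  at most 2 in n needs the third power of the linear factor of each.
\<close>

lemma shift_op_exponential_product:
  fixes z :: "'b \<Rightarrow> 'a :: field"
  assumes fin: "finite A" and z: "\<And>c. c \<in> A \<Longrightarrow> z c \<noteq> 0" and e: "e \<noteq> 0"
    and dvd: "\<And>X. X \<subseteq> A \<Longrightarrow> [:1, - (e * (\<Prod>c\<in>X. z c)):] ^ 3 dvd p"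
  shows "shift_op p (\<lambda>n. (of_int n + r) * (a + of_int n * b) * e powi n *
    (\<Prod>c\<in>A. f c + z c powi n * g c)) n = 0"
proof -
  have expand: "(\<lambda>n. (of_int n + r) * (a + of_int n * b) * e powi n * (\<Prod>c\<in>A. f c + z c powi n * g c)) =
     (\<lambda>n. \<Sum>X\<in>Pow A. ((\<Prod>c\<in>X. g c) * (\<Prod>c\<in>A - X. f c)) *
       ((r * a + of_int n * (a + r * b) + of_int n ^ 2 * b) * (e * (\<Prod>c\<in>X. z c)) powi n))"
  proof
    fix n
    have "(\<Prod>c\<in>A. f c + z c powi n * g c) = (\<Prod>c\<in>A. z c powi n * g c + f c)"
      by (simp add: add.commute)
    also have "\<dots> = (\<Sum>X\<in>Pow A. (\<Prod>c\<in>X. z c powi n * g c) * (\<Prod>c\<in>A - X. f c))"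
      by (rule prod_add[OF fin])
    finally have *: "(\<Prod>c\<in>A. f c + z c powi n * g c) =
        (\<Sum>X\<in>Pow A. (\<Prod>c\<in>X. z c) powi n * (\<Prod>c\<in>X. g c) * (\<Prod>c\<in>A - X. f c))"
      by (simp add: power_int_prod prod.distrib)
    have **: "(of_int n + r) * (a + of_int n * b) = r * a + of_int n * (a + r * b) + of_int n ^ 2 * b"
      by (simp add: algebra_simps power2_eq_square)
    show "(of_int n + r) * (a + of_int n * b) * e powi n * (\<Prod>c\<in>A. f c + z c powi n * g c) =
        (\<Sum>X\<in>Pow A. ((\<Prod>c\<in>X. g c) * (\<Prod>c\<in>A - X. f c)) *
        ((r * a + of_int n * (a + r * b) + of_int n ^ 2 * b) * (e * (\<Prod>c\<in>X. z c)) powi n))"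
      unfolding * ** sum_distrib_left power_int_mult_distrib by (intro sum.cong refl) (simp only: mult_ac)
  qed
  show ?thesis
    unfolding expand shift_op_sum shift_op_scale
  proof (rule sum.neutral, rule ballI)
    fix X assume X: "X \<in> Pow A"
    then have "e * (\<Prod>c\<in>X. z c) \<noteq> 0"
      using e z finite_subset[OF _ fin] by auto
    then show "(\<Prod>c\<in>X. g c) * (\<Prod>c\<in>A - X. f c) *
      shift_op p (\<lambda>n. (r * a + of_int n * (a + r * b) + of_int n ^ 2 * b) * (e * (\<Prod>c\<in>X. z c)) powi n) n = 0"
      using X by (simp add: shift_op_quadratic_exponential dvd)
  qed
qed

section \<open>Products of the zeros of the symbol\<close>

text \<open>
  The right-hand sides are those of \<open>u^3 + 3 u^2 + 3 u + 4 = (u + 1)^3 + 3\<close>, so the zeros are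
  \<open>- 1 - c\<close> for the three cube roots c of 3.
\<close>

lemma exists_cubic_roots:
  "\<exists>u v r :: complex. u + v + r = - 3 \<and> u * v + u * r + v * r = 3 \<and> u * v * r = - 4"
proof -
  define c where "c = complex_of_real (root 3 3)"
  define w where "w = Complex (- 1 / 2) (sqrt 3 / 2)"
  have "root 3 3 ^ 3 = (3 :: real)" by simp
  then have c: "c ^ 3 = 3"
    unfolding c_def by (metis of_real_numeral of_real_power)
  have w: "w ^ 2 + w + 1 = 0"
    by (simp add: w_def complex_eq_iff power2_eq_square field_simps)
  define u v r where "u = - 1 - c" and "v = - 1 - c * w" and "r = - 1 - c * w ^ 2"
  have "u + v + r = - 3 - c * (w ^ 2 + w + 1)"
    by (simp add: u_def v_def r_def algebra_simps)
  moreover have "u * v + u * r + v * r = 3 + (2 * c + c ^ 2 * w) * (w ^ 2 + w + 1)"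
    by (simp add: u_def v_def r_def algebra_simps power2_eq_square)
  moreover have "u * v * r = - 1 - c ^ 3 - (c + c ^ 2 * w + c ^ 3 * (w - 1)) * (w ^ 2 + w + 1)"
    by (simp add: u_def v_def r_def algebra_simps power2_eq_square power3_eq_cube)
  ultimately have "u + v + r = - 3 \<and> u * v + u * r + v * r = 3 \<and> u * v * r = - 4"
    unfolding w c by simp
  then show ?thesis by blast
qed

lemma exists_add_inverse_eq: "\<exists>z :: complex. z \<noteq> 0 \<and> z + 1 / z = u"
proof -
  define z where "z = (u + csqrt (u ^ 2 - 4)) / 2"
  have "csqrt (u ^ 2 - 4) ^ 2 = u ^ 2 - 4" by simp
  moreover have "2 * z = u + csqrt (u ^ 2 - 4)" by (simp add: z_def)
  ultimately have "(2 * z - u) ^ 2 = u ^ 2 - 4" by simp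
  then have "4 * (z * z + 1) = 4 * (u * z)"
    by (simp add: algebra_simps power2_eq_square)
  then have z: "z * z + 1 = u * z"
    using mult_left_cancel[of "4 :: complex" "z * z + 1" "u * z"] by simp
  then have "z \<noteq> 0" by auto
  with z show ?thesis by (intro exI[of _ z]) (simp add: field_simps)
qed

text \<open>
  The product of the four factors whose cubes make up \<open>B4\<close>.
\<close>

definition base_poly :: "complex poly" where
  "base_poly = (let t = [:0, 1:] in
     (t + 1) *
     (t ^ 6 - 3 * t ^ 5 + 6 * t ^ 4 - 10 * t ^ 3 + 6 * t ^ 2 - 3 * t + 1) *
     (t ^ 8 - 4 * t ^ 7 - 17 * t ^ 6 + 8 * t ^ 5 + 49 * t ^ 4 + 8 * t ^ 3 - 17 * t ^ 2
       - 4 * t + 1) *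
     (t ^ 12 + 3 * t ^ 11 + 12 * t ^ 10 + 28 * t ^ 9 - 27 * t ^ 8 + 36 * t ^ 7 - 81 * t ^ 6
       + 36 * t ^ 5 - 27 * t ^ 4 + 28 * t ^ 3 + 12 * t ^ 2 + 3 * t + 1))"

lemma poly_base_poly:
  "poly base_poly t =
     (t + 1) *
     (t ^ 6 - 3 * t ^ 5 + 6 * t ^ 4 - 10 * t ^ 3 + 6 * t ^ 2 - 3 * t + 1) *
     (t ^ 8 - 4 * t ^ 7 - 17 * t ^ 6 + 8 * t ^ 5 + 49 * t ^ 4 + 8 * t ^ 3 - 17 * t ^ 2
       - 4 * t + 1) *
     (t ^ 12 + 3 * t ^ 11 + 12 * t ^ 10 + 28 * t ^ 9 - 27 * t ^ 8 + 36 * t ^ 7 - 81 * t ^ 6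
       + 36 * t ^ 5 - 27 * t ^ 4 + 28 * t ^ 3 + 12 * t ^ 2 + 3 * t + 1)"
proof -
  have "poly [:0, 1:] t = t" by simp
  then show ?thesis
    unfolding base_poly_def Let_def by (simp only: poly_add poly_diff poly_mult poly_power poly_1 poly_numeral)
qed

lemma cubic_of_vieta:
  fixes u v r :: "'a :: comm_ring_1"
  assumes "u + v + r = - 3" "u * v + u * r + v * r = 3" "u * v * r = - 4"
  shows "r ^ 3 + 3 * r ^ 2 + 3 * r + 4 = 0"
proof -
  have "r ^ 3 + 3 * r ^ 2 + 3 * r + 4 =
      (3 + (u + v + r)) * r ^ 2 + (3 - (u * v + u * r + v * r)) * r + (4 + u * v * r)"
    by (simp add: algebra_simps eval_nat_numeral)
  then show ?thesis unfolding assms by simp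
qed

lemma sum_squares_of_vieta:
  fixes u v r :: "'a :: comm_ring_1"
  assumes "u + v + r = - 3" "u * v + u * r + v * r = 3" "u * v * r = - 4"
  shows "u ^ 2 + v ^ 2 + r ^ 2 = 3"
proof -
  have "u ^ 2 + v ^ 2 + r ^ 2 = (u + v + r) ^ 2 - 2 * (u * v + u * r + v * r)"
    by (simp add: algebra_simps eval_nat_numeral)
  then show ?thesis unfolding assms by simp
qed

lemma add_inverse_mult:
  fixes w :: "'a :: field"
  assumes "w \<noteq> 0" shows "w ^ 2 + 1 = (w + 1 / w) * w"
  using assms by (simp add: field_simps power2_eq_square)

text \<open>
  The polynomial is reciprocal, so it is \<open>w^3\<close> times a polynomial in \<open>w + 1/w\<close>, namely the cubic.
\<close>

lemma degree_6_root:
  fixes w u :: "'a :: field"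
  assumes w: "w \<noteq> 0" "w + 1 / w = u" and u: "u ^ 3 + 3 * u ^ 2 + 3 * u + 4 = 0"
  shows "(- w) ^ 6 - 3 * (- w) ^ 5 + 6 * (- w) ^ 4 - 10 * (- w) ^ 3 + 6 * (- w) ^ 2 - 3 * (- w) + 1 = 0"
proof -
  have uw: "w ^ 2 + 1 = u * w" using add_inverse_mult[OF w(1)] w(2) by simp
  have "(- w) ^ 6 - 3 * (- w) ^ 5 + 6 * (- w) ^ 4 - 10 * (- w) ^ 3 + 6 * (- w) ^ 2 - 3 * (- w) + 1 =
      (w ^ 2 + 1) ^ 3 + 3 * w * (w ^ 2 + 1) ^ 2 + 3 * w ^ 2 * (w ^ 2 + 1) + 4 * w ^ 3"
    by (simp add: algebra_simps eval_nat_numeral)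
  also have "\<dots> = w ^ 3 * (u ^ 3 + 3 * u ^ 2 + 3 * u + 4)"
    unfolding uw by (simp add: algebra_simps eval_nat_numeral)
  finally show ?thesis by (simp add: u)
qed

text \<open>
  For \<open>w = x y\<close> the number \<open>a = w + 1/w\<close> is a zero of a quadratic polynomial whose other zero is
  \<open>x/y + y/x\<close>. Multiplied by the third zero r of the cubic and reduced with the relations between u, v
  and r, it becomes a polynomial in a and r alone. Its resultant with the cubic with respect to r is,
  up to a constant factor, the polynomial of degree 6 in a to which the reciprocal polynomial of
  degree 12 reduces.
\<close>

lemma degree_12_root:
  fixes x y u v r :: "'a :: field_char_0"
  assumes x: "x \<noteq> 0" "x + 1 / x = u" and y: "y \<noteq> 0" "y + 1 / y = v"
    and V: "u + v + r = - 3" "u * v + u * r + v * r = 3" "u * v * r = - 4"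
  defines "t \<equiv> - (x * y)"
  shows "t ^ 12 + 3 * t ^ 11 + 12 * t ^ 10 + 28 * t ^ 9 - 27 * t ^ 8 + 36 * t ^ 7 - 81 * t ^ 6
       + 36 * t ^ 5 - 27 * t ^ 4 + 28 * t ^ 3 + 12 * t ^ 2 + 3 * t + 1 = 0"
proof -
  define w where "w = x * y"
  define a where "a = w + 1 / w"
  have w0: "w \<noteq> 0" using x y by (simp add: w_def)
  have aw: "w ^ 2 + 1 = a * w" using add_inverse_mult[OF w0] by (simp add: a_def)
  have quad: "a ^ 2 - u * v * a + u ^ 2 + v ^ 2 - 4 = 0"
    unfolding a_def w_def x(2)[symmetric] y(2)[symmetric]
    using x(1) y(1) by (simp add: field_simps power2_eq_square)
  have cub: "r ^ 3 + 3 * r ^ 2 + 3 * r + 4 = 0" by (rule cubic_of_vieta[OF V])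
  have elim: "3 * r ^ 2 + (a ^ 2 + 2) * r + 4 * a + 4 = 0"
  proof -
    have "3 * r ^ 2 + (a ^ 2 + 2) * r + 4 * a + 4 =
        r * (a ^ 2 - u * v * a + u ^ 2 + v ^ 2 - 4) + (r ^ 3 + 3 * r ^ 2 + 3 * r + 4)
        + a * (4 + u * v * r) + r * (3 - (u ^ 2 + v ^ 2 + r ^ 2))"
      by (simp add: algebra_simps eval_nat_numeral)
    then show ?thesis unfolding quad cub V(3) sum_squares_of_vieta[OF V] by simp
  qed
  \<comment> \<open>The cofactors exhibit the resultant as a combination of the two polynomials in r.\<close>
  have G: "a ^ 6 - 3 * a ^ 5 + 6 * a ^ 4 - 13 * a ^ 3 - 66 * a ^ 2 + 33 * a - 5 = 0"
  proof -
    have "4 * (a ^ 6 - 3 * a ^ 5 + 6 * a ^ 4 - 13 * a ^ 3 - 66 * a ^ 2 + 33 * a - 5) =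
      (17 + 5 * r - r ^ 2 + a * (- 44 + 8 * r + 12 * r ^ 2) + a ^ 2 * (- 1 + 19 * r + 5 * r ^ 2)
        + a ^ 3 * (12 + 4 * r) + a ^ 4 * (- 3 - 3 * r - r ^ 2)) * (3 * r ^ 2 + (a ^ 2 + 2) * r + 4 * a + 4)
      + (- 22 + 3 * r + a * (60 - 36 * r) + a ^ 2 * (- 21 - 15 * r) - 24 * a ^ 3 + a ^ 4 * (- 3 + 3 * r) + a ^ 6)
        * (r ^ 3 + 3 * r ^ 2 + 3 * r + 4)"
      by (simp add: algebra_simps eval_nat_numeral)
    then have "4 * (a ^ 6 - 3 * a ^ 5 + 6 * a ^ 4 - 13 * a ^ 3 - 66 * a ^ 2 + 33 * a - 5) = 0"
      by (simp only: elim cub mult_zero_right add_0_right)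
    then show ?thesis by (simp only: mult_eq_0_iff zero_neq_numeral[symmetric] simp_thms)
  qed
  have "t ^ 12 + 3 * t ^ 11 + 12 * t ^ 10 + 28 * t ^ 9 - 27 * t ^ 8 + 36 * t ^ 7 - 81 * t ^ 6
       + 36 * t ^ 5 - 27 * t ^ 4 + 28 * t ^ 3 + 12 * t ^ 2 + 3 * t + 1 =
     (w ^ 2 + 1) ^ 6 - 3 * w * (w ^ 2 + 1) ^ 5 + 6 * w ^ 2 * (w ^ 2 + 1) ^ 4 - 13 * w ^ 3 * (w ^ 2 + 1) ^ 3
       - 66 * w ^ 4 * (w ^ 2 + 1) ^ 2 + 33 * w ^ 5 * (w ^ 2 + 1) - 5 * w ^ 6"
    unfolding t_def w_def[symmetric] by (simp add: algebra_simps eval_nat_numeral)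
  also have "\<dots> = w ^ 6 * (a ^ 6 - 3 * a ^ 5 + 6 * a ^ 4 - 13 * a ^ 3 - 66 * a ^ 2 + 33 * a - 5)"
    unfolding aw by (simp add: algebra_simps eval_nat_numeral)
  finally show ?thesis by (simp add: G)
qed

text \<open>
  The four numbers \<open>w + 1/w\<close> for \<open>w = x y z\<close>, \<open>x y / z\<close>, \<open>x z / y\<close>, \<open>y z / x\<close> are the zeros of a quartic
  with coefficients symmetric in u, v and r, hence rational. It is the product of the quadratics
  belonging to the two numbers \<open>a = x y + 1/(x y)\<close> and \<open>b = x/y + y/x\<close>.
\<close>

lemma degree_8_root:
  fixes x y z u v r :: "'a :: field"
  assumes x: "x \<noteq> 0" "x + 1 / x = u" and y: "y \<noteq> 0" "y + 1 / y = v" and z: "z \<noteq> 0" "z + 1 / z = r"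
    and V: "u + v + r = - 3" "u * v + u * r + v * r = 3" "u * v * r = - 4"
  defines "t \<equiv> - (x * y * z)"
  shows "t ^ 8 - 4 * t ^ 7 - 17 * t ^ 6 + 8 * t ^ 5 + 49 * t ^ 4 + 8 * t ^ 3 - 17 * t ^ 2 - 4 * t + 1 = 0"
proof -
  define a where "a = x * y + 1 / (x * y)"
  define b where "b = x / y + y / x"
  define w where "w = x * y * z"
  define p where "p = w + 1 / w"
  have w0: "w \<noteq> 0" using x y z by (simp add: w_def)
  have pw: "w ^ 2 + 1 = p * w" using add_inverse_mult[OF w0] by (simp add: p_def)
  have ab: "a + b = u * v" "a * b = u ^ 2 + v ^ 2 - 4"
    unfolding a_def b_def x(2)[symmetric] y(2)[symmetric]
    using x(1) y(1) by (simp_all add: field_simps power2_eq_square)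
  have quad: "p ^ 2 - a * r * p + a ^ 2 + r ^ 2 - 4 = 0"
    unfolding p_def w_def a_def z(2)[symmetric]
    using x(1) y(1) z(1) by (simp add: field_simps power2_eq_square)
  have m2: "u ^ 2 + v ^ 2 + r ^ 2 = 3" by (rule sum_squares_of_vieta[OF V])
  have n2: "u ^ 2 * v ^ 2 + u ^ 2 * r ^ 2 + v ^ 2 * r ^ 2 = - 15"
  proof -
    have "u ^ 2 * v ^ 2 + u ^ 2 * r ^ 2 + v ^ 2 * r ^ 2 =
        (u * v + u * r + v * r) ^ 2 - 2 * (u * v * r) * (u + v + r)"
      by (simp add: algebra_simps eval_nat_numeral)
    then show ?thesis unfolding V by simp
  qed
  have c2: "a * b * r ^ 2 + (a ^ 2 + b ^ 2) + 2 * (r ^ 2 - 4) = - 21"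
  proof -
    have "a * b * r ^ 2 + (a ^ 2 + b ^ 2) + 2 * (r ^ 2 - 4) =
        a * b * r ^ 2 + ((a + b) ^ 2 - 2 * (a * b)) + 2 * (r ^ 2 - 4)"
      by (simp add: algebra_simps eval_nat_numeral)
    also have "\<dots> = (u ^ 2 * v ^ 2 + u ^ 2 * r ^ 2 + v ^ 2 * r ^ 2) - 2 * (u ^ 2 + v ^ 2 + r ^ 2)"
      unfolding ab by (simp add: algebra_simps eval_nat_numeral)
    finally show ?thesis unfolding m2 n2 by simp
  qed
  have c3: "(a + b) * r = - 4" using ab V by simp
  have c1: "a * b * (a + b) * r + (a + b) * (r ^ 2 - 4) * r = 20"
  proof -
    have "a * b * (a + b) * r + (a + b) * (r ^ 2 - 4) * r = (a + b) * r * (a * b + r ^ 2 - 4)"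
      by (simp add: algebra_simps)
    also have "\<dots> = (- 4) * ((u ^ 2 + v ^ 2 + r ^ 2) - 8)"
      unfolding c3 ab(2) by simp
    finally show ?thesis unfolding m2 by simp
  qed
  have c0: "(a ^ 2 + r ^ 2 - 4) * (b ^ 2 + r ^ 2 - 4) = 85"
  proof -
    have "(a ^ 2 + r ^ 2 - 4) * (b ^ 2 + r ^ 2 - 4) =
        (a * b) ^ 2 + (r ^ 2 - 4) * ((a + b) ^ 2 - 2 * (a * b)) + (r ^ 2 - 4) ^ 2"
      by (simp add: algebra_simps eval_nat_numeral)
    also have "\<dots> = (u ^ 2 + v ^ 2 + r ^ 2) ^ 2 - 4 * (u ^ 2 * v ^ 2 + u ^ 2 * r ^ 2 + v ^ 2 * r ^ 2) + (u * v * r) ^ 2"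
      unfolding ab by (simp add: algebra_simps eval_nat_numeral)
    also have "\<dots> = 85" unfolding m2 n2 V(3) by simp
    finally show ?thesis .
  qed
  have "(p ^ 2 - a * r * p + a ^ 2 + r ^ 2 - 4) * (p ^ 2 - b * r * p + b ^ 2 + r ^ 2 - 4) =
      p ^ 4 - ((a + b) * r) * p ^ 3 + (a * b * r ^ 2 + (a ^ 2 + b ^ 2) + 2 * (r ^ 2 - 4)) * p ^ 2
      - (a * b * (a + b) * r + (a + b) * (r ^ 2 - 4) * r) * p + (a ^ 2 + r ^ 2 - 4) * (b ^ 2 + r ^ 2 - 4)"
    by (simp add: algebra_simps eval_nat_numeral)
  also have "\<dots> = p ^ 4 + 4 * p ^ 3 - 21 * p ^ 2 - 20 * p + 85"
    unfolding c0 c1 c2 c3 by simp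
  finally have G: "p ^ 4 + 4 * p ^ 3 - 21 * p ^ 2 - 20 * p + 85 = 0"
    unfolding quad by simp
  have "t ^ 8 - 4 * t ^ 7 - 17 * t ^ 6 + 8 * t ^ 5 + 49 * t ^ 4 + 8 * t ^ 3 - 17 * t ^ 2 - 4 * t + 1 =
     (w ^ 2 + 1) ^ 4 + 4 * w * (w ^ 2 + 1) ^ 3 - 21 * w ^ 2 * (w ^ 2 + 1) ^ 2 - 20 * w ^ 3 * (w ^ 2 + 1) + 85 * w ^ 4"
    unfolding t_def w_def[symmetric] by (simp add: algebra_simps eval_nat_numeral)
  also have "\<dots> = w ^ 4 * (p ^ 4 + 4 * p ^ 3 - 21 * p ^ 2 - 20 * p + 85)"
    unfolding pw by (simp add: algebra_simps eval_nat_numeral)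
  finally show ?thesis by (simp add: G)
qed

text \<open>
  The number of factors different from 1 decides which of the four factors of the polynomial vanishes.
  Since x may be replaced by 1/x in the hypotheses, all choices from the pairs of zeros are covered.
\<close>

lemma base_poly_root:
  fixes x y z :: complex
  assumes V: "u + v + r = - 3" "u * v + u * r + v * r = 3" "u * v * r = - 4"
    and x: "x = 1 \<or> x \<noteq> 0 \<and> x + 1 / x = u"
    and y: "y = 1 \<or> y \<noteq> 0 \<and> y + 1 / y = v"
    and z: "z = 1 \<or> z \<noteq> 0 \<and> z + 1 / z = r"
  shows "poly base_poly (- (x * y * z)) = 0"
proof -
  have V1: "u + r + v = - 3" "u * r + u * v + r * v = 3" "u * r * v = - 4"
    and V2: "v + r + u = - 3" "v * r + v * u + r * u = 3" "v * r * u = - 4"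
    using V by (simp_all add: ac_simps)
  have cu: "u ^ 3 + 3 * u ^ 2 + 3 * u + 4 = 0" and cv: "v ^ 3 + 3 * v ^ 2 + 3 * v + 4 = 0"
    and cr: "r ^ 3 + 3 * r ^ 2 + 3 * r + 4 = 0"
    using cubic_of_vieta[OF V2] cubic_of_vieta[OF V1] cubic_of_vieta[OF V] .
  show ?thesis
  proof (cases "x = 1"; cases "y = 1"; cases "z = 1")
    assume "x = 1" "y = 1" "z = 1"
    then show ?thesis by (simp add: poly_base_poly)
  next
    assume "x = 1" "y = 1" "z \<noteq> 1"
    then show ?thesis using degree_6_root[OF _ _ cr, of z] z by (simp only: poly_base_poly) simp
  next
    assume "x = 1" "y \<noteq> 1" "z = 1"
    then show ?thesis using degree_6_root[OF _ _ cv, of y] y by (simp only: poly_base_poly) simp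
  next
    assume "x \<noteq> 1" "y = 1" "z = 1"
    then show ?thesis using degree_6_root[OF _ _ cu, of x] x by (simp only: poly_base_poly) simp
  next
    assume "x = 1" "y \<noteq> 1" "z \<noteq> 1"
    then show ?thesis using degree_12_root[OF _ _ _ _ V2, of y z] y z by (simp only: poly_base_poly mult_1_left) simp
  next
    assume "x \<noteq> 1" "y = 1" "z \<noteq> 1"
    then show ?thesis using degree_12_root[OF _ _ _ _ V1, of x z] x z by (simp only: poly_base_poly mult_1_right) simp
  next
    assume "x \<noteq> 1" "y \<noteq> 1" "z = 1"
    then show ?thesis using degree_12_root[OF _ _ _ _ V, of x y] x y by (simp only: poly_base_poly mult_1_right) simp
  next
    assume "x \<noteq> 1" "y \<noteq> 1" "z \<noteq> 1"
    then show ?thesis using degree_8_root[OF _ _ _ _ _ _ V, of x y z] x y z by (simp only: poly_base_poly) simp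
  qed
qed

section \<open>A basis of solutions of the interior equations\<close>

definition basis :: "(nat \<Rightarrow> 'a :: field) \<Rightarrow> nat \<Rightarrow> int \<Rightarrow> 'a" where
  "basis z c j = (if c = 0 then 1 else if c = 1 then of_int j else z c powi j)"

text \<open>
  The symbol, multiplied by \<open>- z^4\<close>, is \<open>(z - 1)^2\<close> times the reciprocal polynomial of
  \<open>degree_6_root\<close>. The double zero 1 is the reason for the solutions \<open>1\<close> and \<open>j\<close>.
\<close>

lemma characteristic_root:
  fixes z u :: "'a :: field"
  assumes z: "z \<noteq> 0" "z + 1 / z = u" and u: "u ^ 3 + 3 * u ^ 2 + 3 * u + 4 = 0"
  shows "8 * z ^ 4 = 1 + z + z ^ 2 + z ^ 3 + z ^ 5 + z ^ 6 + z ^ 7 + z ^ 8"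
proof -
  have "1 + z + z ^ 2 + z ^ 3 + z ^ 5 + z ^ 6 + z ^ 7 + z ^ 8 - 8 * z ^ 4 =
      (z - 1) ^ 2 * ((- z) ^ 6 - 3 * (- z) ^ 5 + 6 * (- z) ^ 4 - 10 * (- z) ^ 3 + 6 * (- z) ^ 2 - 3 * (- z) + 1)"
    by (simp add: algebra_simps eval_nat_numeral)
  then show ?thesis
    unfolding degree_6_root[OF z u] by simp
qed

lemma basis_recurrence:
  fixes z :: "nat \<Rightarrow> 'a :: field"
  assumes "\<And>c. c \<in> {2..<8} \<Longrightarrow> z c \<noteq> 0"
    and "\<And>c. c \<in> {2..<8} \<Longrightarrow> 8 * z c ^ 4 = 1 + z c + z c ^ 2 + z c ^ 3 + z c ^ 5 + z c ^ 6 + z c ^ 7 + z c ^ 8"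
    and "c < 8"
  shows "8 * basis z c (j + 4) = basis z c j + basis z c (j + 1) + basis z c (j + 2) + basis z c (j + 3)
    + basis z c (j + 5) + basis z c (j + 6) + basis z c (j + 7) + basis z c (j + 8)"
proof (cases "c < 2")
  case True
  then have "c = 0 \<or> c = 1" by linarith
  then show ?thesis by (auto simp: basis_def)
next
  case False
  with assms have z: "z c \<noteq> 0" and
    e: "8 * z c ^ 4 = 1 + z c + z c ^ 2 + z c ^ 3 + z c ^ 5 + z c ^ 6 + z c ^ 7 + z c ^ 8" by auto
  have p: "z c powi (j + int k) = z c powi j * z c ^ k" for k
    using z by (simp add: power_int_add)
  have "8 * (z c powi j * z c ^ 4) = z c powi j * (8 * z c ^ 4)" by simp
  also have "\<dots> = z c powi j * 1 + z c powi j * z c ^ 1 + z c powi j * z c ^ 2 + z c powi j * z c ^ 3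
      + z c powi j * z c ^ 5 + z c powi j * z c ^ 6 + z c powi j * z c ^ 7 + z c powi j * z c ^ 8"
    unfolding e by (simp add: algebra_simps)
  finally show ?thesis
    using False p[of 1] by (simp add: basis_def p[symmetric])
qed

text \<open>
  A confluent Vandermonde determinant: a vector in the kernel of the transpose is the coefficient vector
  of a polynomial of degree at most 7 with a double zero at 1 and six further zeros.
\<close>

lemma det_start_mat_nonzero:
  fixes z :: "nat \<Rightarrow> 'a :: field"
  assumes inj: "inj_on z {2..<8}" and ne: "\<And>c. c \<in> {2..<8} \<Longrightarrow> z c \<noteq> 1"
  shows "det (start_mat (\<lambda>c j. basis z c (int j))) \<noteq> 0"
proof
  let ?V = "start_mat (\<lambda>c j. basis z c (int j))"
  assume "det ?V = 0"
  have V: "?V \<in> carrier_mat 8 8" by (simp add: start_mat_def)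
  have "det (transpose_mat ?V) = 0" using det_transpose[OF V] \<open>det ?V = 0\<close> by simp
  then obtain v where v: "v \<in> carrier_vec 8" "v \<noteq> 0\<^sub>v 8" "transpose_mat ?V *\<^sub>v v = 0\<^sub>v 8"
    using det_0_iff_vec_prod_zero[of "transpose_mat ?V" 8] V by auto
  have rel: "(\<Sum>s<8. basis z c (int s) * v $ s) = 0" if "c < 8" for c
  proof -
    have "(transpose_mat ?V *\<^sub>v v) $ c = 0" using v(3) that by simp
    moreover have "(transpose_mat ?V *\<^sub>v v) $ c = (\<Sum>s<8. basis z c (int s) * v $ s)"
      using that v(1) by (simp add: start_mat_def scalar_prod_def atLeast0LessThan)
    ultimately show ?thesis by simp
  qed
  define y where "y = (\<Sum>s<8. monom (v $ s) s)"
  have deg: "degree y \<le> 7"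
    unfolding y_def by (intro degree_sum_le) (auto intro: order_trans[OF degree_monom_le])
  have coeff_y: "coeff y s = v $ s" if "s < 8" for s
    using that by (simp add: y_def coeff_sum)
  have poly_y: "poly y x = (\<Sum>s<8. x ^ s * v $ s)" for x
    by (simp add: y_def poly_sum poly_monom mult.commute)
  have y1: "poly y 1 = 0"
    using rel[of 0] by (simp add: poly_y basis_def)
  have "poly (pderiv y) 1 = (\<Sum>s<8. of_nat s * v $ s)"
    by (simp add: y_def lessThan_nat_numeral pderiv_add pderiv_monom poly_monom)
  then have y1': "poly (pderiv y) 1 = 0"
    using rel[of 1] by (simp add: basis_def)
  have yz: "poly y (z c) = 0" if "c \<in> {2..<8}" for c
    using rel[of c] that by (simp add: poly_y basis_def)
  obtain g where g: "y = [:- 1, 1:] * g"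
    using y1 by (auto simp: poly_eq_0_iff_dvd dvd_def)
  have "poly g 1 = 0"
    using y1' unfolding g by (simp add: pderiv_diff pderiv_pCons)
  then obtain q where q: "g = [:- 1, 1:] * q"
    by (auto simp: poly_eq_0_iff_dvd dvd_def)
  have "q = 0"
  proof (rule ccontr)
    assume q0: "q \<noteq> 0"
    have "degree y = 2 + degree q"
      using q0 unfolding g q by (simp add: degree_mult_eq del: mult_pCons_left)
    then have dq: "degree q \<le> 5" using deg by simp
    have "z ` {2..<8} \<subseteq> {x. poly q x = 0}"
    proof
      fix x assume "x \<in> z ` {2..<8}"
      then obtain c where c: "c \<in> {2..<8}" "x = z c" by blast
      show "x \<in> {x. poly q x = 0}"
      proof -
        have "poly y (z c) = (z c - 1) ^ 2 * poly q (z c)"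
          by (simp add: g q algebra_simps power2_eq_square)
        then show ?thesis using yz[OF c(1)] ne[OF c(1)] c(2) by simp
      qed
    qed
    then have "card (z ` {2..<8}) \<le> card {x. poly q x = 0}"
      using poly_roots_finite[OF q0] by (intro card_mono)
    also have "\<dots> \<le> degree q" by (rule card_poly_roots_bound[OF q0])
    finally show False
      using dq card_image[OF inj] by simp
  qed
  then have "y = 0" by (simp add: g q)
  then have "v $ s = 0" if "s < 8" for s
    using coeff_y[OF that] by simp
  then have "v = 0\<^sub>v 8" using v(1) by (intro eq_vecI) auto
  with v(2) show False by simp
qed

definition boundary_int_mat :: "(nat \<Rightarrow> 'a :: field) \<Rightarrow> int \<Rightarrow> 'a mat" where
  "boundary_int_mat z m = mat 8 8 (\<lambda>(k, c). \<Sum>s<8. head_coeff k s * basis z c (int s)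
     + tail_coeff k s * basis z c (m + int s))"

lemma boundary_int_mat_of_nat: "boundary_int_mat z (int m) = boundary_mat (\<lambda>c j. basis z c (int j)) m"
  by (simp add: boundary_int_mat_def boundary_mat_def)

text \<open>
  At \<open>m = -1\<close> the tail of a sequence starts at position -1. Solving the interior equation for this value
  expresses it through the positions 0 to 7, with the coefficients 8 at position 3 and -1 elsewhere.
\<close>

definition shift_back_mat :: "'a :: comm_ring_1 mat" where
  "shift_back_mat = mat 8 8 (\<lambda>(k, s). head_coeff k s + (if s < 7 then tail_coeff k (s + 1) else 0)
     + tail_coeff k 0 * (if s = 3 then 8 else - 1))"

lemma boundary_int_mat_minus_1:
  fixes z :: "nat \<Rightarrow> 'a :: field"
  assumes rec: "\<And>c j. c < 8 \<Longrightarrow> 8 * basis z c (j + 4) = basis z c j + basis z c (j + 1) + basis z c (j + 2)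
    + basis z c (j + 3) + basis z c (j + 5) + basis z c (j + 6) + basis z c (j + 7) + basis z c (j + 8)"
  shows "boundary_int_mat z (- 1) = shift_back_mat * start_mat (\<lambda>c j. basis z c (int j))"
proof (rule eq_matI)
  fix k c
  assume "k < dim_row (shift_back_mat * start_mat (\<lambda>c j. basis z c (int j)))"
    and "c < dim_col (shift_back_mat * start_mat (\<lambda>c j. basis z c (int j)))"
  then have k: "k < 8" and c: "c < 8" by (simp_all add: shift_back_mat_def start_mat_def)
  have s8: "{..<8::nat} = {0, 1, 2, 3, 4, 5, 6, 7}" by auto
  have b: "basis z c (- 1) = 8 * basis z c 3 - basis z c 0 - basis z c 1 - basis z c 2 - basis z c 4
      - basis z c 5 - basis z c 6 - basis z c 7"
    using rec[OF c, of "- 1"] by simp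
  have "(shift_back_mat * start_mat (\<lambda>c j. basis z c (int j))) $$ (k, c) =
      (\<Sum>s<8. (head_coeff k s + (if s < 7 then tail_coeff k (s + 1) else 0)
     + tail_coeff k 0 * (if s = 3 then 8 else - 1)) * basis z c (int s))"
    using k c by (simp add: shift_back_mat_def start_mat_def scalar_prod_def atLeast0LessThan)
  also have "\<dots> = (\<Sum>s<8. head_coeff k s * basis z c (int s) + tail_coeff k s * basis z c (- 1 + int s))"
    unfolding s8 by (simp add: b numeral_2_eq_2[symmetric]) (simp add: algebra_simps)
  finally show "boundary_int_mat z (- 1) $$ (k, c) =
      (shift_back_mat * start_mat (\<lambda>c j. basis z c (int j))) $$ (k, c)"
    using k c by (simp add: boundary_int_mat_def)
qed (simp_all add: boundary_int_mat_def shift_back_mat_def start_mat_def)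

text \<open>
  63 times the inverse of \<open>shift_back_mat\<close>.
\<close>

definition shift_back_inverse :: "nat \<Rightarrow> nat \<Rightarrow> 'a :: comm_ring_1" where
  "shift_back_inverse i j = [[0, 0, 0, 0, 63, 0, 0, 0],
     [8, 7, 9, 8, 63, 16, 8, 8],
     [8, 7, 8, 9, 63, 8, 16, 8],
     [17, 7, 8, 8, 63, 8, 8, 17],
     [7, 14, 7, 7, 63, 7, 7, 7],
     [8, 7, 16, 8, 63, 9, 8, 8],
     [8, 7, 8, 16, 63, 8, 9, 8],
     [80, 7, 8, 8, 63, 8, 8, 17]] ! i ! j"

lemma det_shift_back_mat_nonzero: "det (shift_back_mat :: 'a :: field_char_0 mat) \<noteq> 0"
proof -
  have s8: "{..<8::nat} = {0, 1, 2, 3, 4, 5, 6, 7}" by auto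
  have "\<forall>i\<in>{..<8}. \<forall>j\<in>{..<8}. (\<Sum>s\<in>{..<8}. (head_coeff i s + (if s < 7 then tail_coeff i (s + 1) else 0)
     + tail_coeff i 0 * (if s = 3 then 8 else - 1)) * shift_back_inverse s j) = (if i = j then 63 else 0 :: 'a)"
    unfolding s8 by (simp add: head_coeff_def tail_coeff_def shift_back_inverse_def)
  then have "shift_back_mat * mat 8 8 (\<lambda>(i, j). shift_back_inverse i j) = (63 :: 'a) \<cdot>\<^sub>m 1\<^sub>m 8"
    by (intro eq_matI) (simp_all add: shift_back_mat_def scalar_prod_def atLeast0LessThan)
  then have "det (shift_back_mat :: 'a mat) * det (mat 8 8 (\<lambda>(i, j). shift_back_inverse i j)) = 63 ^ 8"
    by (subst det_mult[symmetric, of _ 8]) (simp_all add: shift_back_mat_def)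
  then show ?thesis by auto
qed

section \<open>The generating function\<close>

interpretation of_rat_hom: field_hom "of_rat :: rat \<Rightarrow> complex"
  by unfold_locales (auto simp: of_rat_add of_rat_mult of_rat_minus of_rat_divide)
interpretation of_rat_poly_hom: map_poly_comm_ring_hom "of_rat :: rat \<Rightarrow> complex" ..
lemma map_poly_B4: "map_poly (of_rat :: rat \<Rightarrow> complex) B4 = base_poly ^ 3"
proof -
  have t: "map_poly (of_rat :: rat \<Rightarrow> complex) [:0, 1:] = [:0, 1:]" by simp
  show ?thesis
    unfolding B4_def base_poly_def Let_def
    by (simp only: power_mult_distrib t of_rat_poly_hom.hom_mult of_rat_poly_hom.hom_add of_rat_poly_hom.hom_minus
      of_rat_poly_hom.hom_power of_rat_poly_hom.hom_one of_rat_poly_hom.hom_numeral)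
qed

lemma B4_monic: "degree B4 = 81" "coeff B4 81 = 1"
proof -
  define f6 f8 f12 :: "rat poly" where
    "f6 = [:1, - 3, 6, - 10, 6, - 3, 1:]" and
    "f8 = [:1, - 4, - 17, 8, 49, 8, - 17, - 4, 1:]" and
    "f12 = [:1, 3, 12, 28, - 27, 36, - 81, 36, - 27, 28, 12, 3, 1:]"
  have B4: "B4 = [:1, 1:] ^ 3 * f6 ^ 3 * f8 ^ 3 * f12 ^ 3"
    unfolding B4_def Let_def f6_def f8_def f12_def
    by (intro arg_cong2[of _ _ _ _ "(*)"] arg_cong[of _ _ "\<lambda>x. x ^ 3"])
      (simp_all add: eval_nat_numeral numeral_poly one_pCons)
  have nz: "f6 \<noteq> 0" "f8 \<noteq> 0" "f12 \<noteq> 0" "[:1, 1 :: rat:] \<noteq> 0"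
    by (simp_all add: f6_def f8_def f12_def)
  have deg: "degree f6 = 6" "degree f8 = 8" "degree f12 = 12" "degree [:1, 1 :: rat:] = 1"
    by (simp_all add: f6_def f8_def f12_def)
  have lead: "lead_coeff f6 = 1" "lead_coeff f8 = 1" "lead_coeff f12 = 1" "lead_coeff [:1, 1 :: rat:] = 1"
    by (simp_all add: f6_def f8_def f12_def)
  show d: "degree B4 = 81"
    unfolding B4 by (simp only: degree_mult_eq degree_power_eq power_eq_0_iff mult_eq_0_iff nz deg simp_thms)
  have "lead_coeff B4 = 1"
    unfolding B4 by (simp only: lead_coeff_mult lead_coeff_power lead power_one mult_1_left)
  then show "coeff B4 81 = 1" by (simp add: d)
qed

text \<open>
  A double zero u of \<open>(u + 1)^3 + 3\<close> would have to be -1.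
\<close>

lemma vieta_distinct:
  fixes u v r :: complex
  assumes V: "u + v + r = - 3" "u * v + u * r + v * r = 3" "u * v * r = - 4"
  shows "u \<noteq> v"
proof
  assume uv: "u = v"
  have r: "r = - 3 - 2 * u" using V(1) uv by (simp add: algebra_simps)
  have "3 * (u + 1) ^ 2 = 3 - (u * v + u * r + v * r)"
    unfolding uv[symmetric] r by (simp add: algebra_simps power2_eq_square)
  then have u: "u = - 1" unfolding V(2) by (simp add: add_eq_0_iff2)
  then have "v = - 1" "r = - 1" using uv r by simp_all
  with V(3) u show False by simp
qed

lemma cubic_root_square_ne_4:
  fixes u :: complex
  assumes "u ^ 3 + 3 * u ^ 2 + 3 * u + 4 = 0"
  shows "u ^ 2 \<noteq> 4"
proof
  assume "u ^ 2 = 4"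
  then have "u = 2 \<or> u = - 2" using power2_eq_iff[of u 2] by simp
  with assms show False by auto
qed

text \<open>
  The sequence is the exponential polynomial given by the 8 by 8 determinant on all integers; dividing
  by the determinant of the starting values undoes the change of basis.
\<close>

lemma exists_leaf_recurrence:
  "\<exists>h :: int \<Rightarrow> complex. (\<forall>m. h (int m) = of_nat (ug_total_leaves (ug_power (cycle_ugraph (m + 9)) 4)))
     \<and> h (- 1) \<noteq> 0 \<and> (\<forall>n. shift_op (base_poly ^ 3) h n = 0)"
proof -
  obtain u v r :: complex where V: "u + v + r = - 3" "u * v + u * r + v * r = 3" "u * v * r = - 4"
    using exists_cubic_roots by blast
  have V1: "u + r + v = - 3" "u * r + u * v + r * v = 3" "u * r * v = - 4"
    and V2: "v + r + u = - 3" "v * r + v * u + r * u = 3" "v * r * u = - 4"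
    using V by (simp_all add: ac_simps)
  have cu: "u ^ 3 + 3 * u ^ 2 + 3 * u + 4 = 0" and cv: "v ^ 3 + 3 * v ^ 2 + 3 * v + 4 = 0"
    and cr: "r ^ 3 + 3 * r ^ 2 + 3 * r + 4 = 0"
    using cubic_of_vieta[OF V2] cubic_of_vieta[OF V1] cubic_of_vieta[OF V] .
  have dist: "u \<noteq> v" "u \<noteq> r" "v \<noteq> r"
    using vieta_distinct[OF V] vieta_distinct[OF V1] vieta_distinct[OF V2] by auto
  obtain x y w where x: "x \<noteq> 0" "x + 1 / x = u" and y: "y \<noteq> 0" "y + 1 / y = v"
    and w: "w \<noteq> 0" "w + 1 / w = r"
    using exists_add_inverse_eq by metis
  define z where "z c = (if c = 2 then x else if c = 3 then 1 / x else if c = 4 then y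
    else if c = 5 then 1 / y else if c = 6 then w else 1 / w)" for c :: nat
  define U where "U c = (if c < 4 then u else if c < 6 then v else r)" for c :: nat
  have idx: "c = 2 \<or> c = 3 \<or> c = 4 \<or> c = 5 \<or> c = 6 \<or> c = 7" if "c \<in> {2..<8}" for c :: nat
    using that by auto
  have z0: "z c \<noteq> 0" and zU: "z c + 1 / z c = U c" if "c \<in> {2..<8}" for c
    using idx[OF that] x y w by (auto simp: z_def U_def add.commute)
  have U: "U c ^ 3 + 3 * U c ^ 2 + 3 * U c + 4 = 0" for c
    using cu cv cr by (simp add: U_def)
  have sq: "z c ^ 2 \<noteq> 1" if c: "c \<in> {2..<8}" for c
  proof
    assume "z c ^ 2 = 1"
    then have "z c = 1 \<or> z c = - 1" by (simp add: power2_eq_1_iff)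
    then have "U c ^ 2 = 4" using zU[OF c] by auto
    with cubic_root_square_ne_4[OF U] show False by blast
  qed
  have z1: "z c \<noteq> 1" if "c \<in> {2..<8}" for c using sq[OF that] by auto
  have inj: "inj_on z {2..<8}"
  proof
    fix c d assume c: "c \<in> {2..<8}" and d: "d \<in> {2..<8}" and eq: "z c = z d"
    have "U c = U d" using zU[OF c] zU[OF d] eq by simp
    moreover have "x \<noteq> 1 / x" "y \<noteq> 1 / y" "w \<noteq> 1 / w"
      using sq[of 2] sq[of 4] sq[of 6] x(1) y(1) w(1)
      by (auto simp: z_def power2_eq_square nonzero_eq_divide_eq)
    ultimately show "c = d"
      using idx[OF c] idx[OF d] eq dist by (auto simp: U_def z_def)
  qed
  have rec: "8 * basis z c (j + 4) = basis z c j + basis z c (j + 1) + basis z c (j + 2)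
    + basis z c (j + 3) + basis z c (j + 5) + basis z c (j + 6) + basis z c (j + 7) + basis z c (j + 8)"
    if "c < 8" for c j
    using z0 characteristic_root[OF z0 zU U] that by (intro basis_recurrence)
  let ?V = "start_mat (\<lambda>c j. basis z c (int j))"
  have detV: "det ?V \<noteq> 0" by (rule det_start_mat_nonzero[OF inj z1])
  have Vc: "?V \<in> carrier_mat 8 8" by (simp add: start_mat_def)
  define h where "h m = (of_int m + 9) * 8 * (- 1) powi m * det (boundary_int_mat z m) / det ?V" for m
  have "h (int m) = of_nat (ug_total_leaves (ug_power (cycle_ugraph (m + 9)) 4))" for m
  proof -
    have "det (leaf_mat (m + 8)) * det ?V = (- 1) ^ m * det (boundary_int_mat z (int m))"
      unfolding boundary_int_mat_of_nat
      using rec[of _ "int j" for j] by (intro det_leaf_mat_reduction) (simp add: add.commute)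
    then have "h (int m) = (of_nat m + 9) * 8 * (det (leaf_mat (m + 8)) * det ?V) / det ?V"
      by (simp add: h_def)
    also have "\<dots> = of_nat (8 * (m + 9)) * det (leaf_mat (m + 9 - 1))"
      using detV by (simp add: nonzero_divide_eq_eq algebra_simps)
    finally show ?thesis by (simp only: total_leaves_eq_det le_add2)
  qed
  moreover have "h (- 1) \<noteq> 0"
  proof -
    have "(shift_back_mat :: complex mat) \<in> carrier_mat 8 8" by (simp add: shift_back_mat_def)
    moreover have "boundary_int_mat z (- 1) = shift_back_mat * ?V"
      by (rule boundary_int_mat_minus_1) (rule rec)
    ultimately have "det (boundary_int_mat z (- 1)) = det shift_back_mat * det ?V"
      using Vc by (simp only: det_mult)
    then show ?thesis
      using detV det_shift_back_mat_nonzero[where ?'a = complex] by (simp add: h_def)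
  qed
  moreover have "shift_op (base_poly ^ 3) h n = 0" for n
  proof -
    have dvd: "[:1, - (- 1 * (\<Prod>c\<in>X. z c)):] ^ 3 dvd base_poly ^ 3" if X: "X \<subseteq> {2..<8}" for X
    proof -
      \<comment> \<open>The columns 2 and 3, 4 and 5, 6 and 7 belong to mutually inverse numbers, so each of
        these pairs contributes 1, one of its numbers, or their product 1.\<close>
      define p where "p a b = (if a \<in> X then z a else 1) * (if b \<in> X then z b else 1)" for a b
      have "(\<Prod>c\<in>X. z c) = (\<Prod>c\<in>{2..<8}. if c \<in> X then z c else 1)"
        using X by (subst prod.inter_restrict[symmetric]) (simp_all add: Int_absorb1)
      also have "{2..<8} = {2, 3, 4, 5, 6, 7 :: nat}" by auto
      finally have prod: "(\<Prod>c\<in>X. z c) = p 2 3 * p 4 5 * p 6 7"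
        by (simp add: p_def mult_ac)
      have "1 / p 2 3 = 1 \<or> 1 / p 2 3 \<noteq> 0 \<and> 1 / p 2 3 + 1 / (1 / p 2 3) = u"
        "1 / p 4 5 = 1 \<or> 1 / p 4 5 \<noteq> 0 \<and> 1 / p 4 5 + 1 / (1 / p 4 5) = v"
        "1 / p 6 7 = 1 \<or> 1 / p 6 7 \<noteq> 0 \<and> 1 / p 6 7 + 1 / (1 / p 6 7) = r"
        using x y w by (auto simp: p_def z_def add.commute)
      from base_poly_root[OF V this]
      have root: "poly base_poly (- (1 / (\<Prod>c\<in>X. z c))) = 0" by (simp add: prod)
      have nz: "(\<Prod>c\<in>X. z c) \<noteq> 0"
        using z0 X finite_subset[OF X] by (auto simp: prod_zero_iff)
      have "[:1, - (- 1 * (\<Prod>c\<in>X. z c)):] = Polynomial.smult (\<Prod>c\<in>X. z c) [:- (- (1 / (\<Prod>c\<in>X. z c))), 1:]"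
        using nz by simp
      also have "\<dots> dvd base_poly"
        using root nz by (simp only: smult_dvd_iff poly_eq_0_iff_dvd) simp
      finally show ?thesis by (rule dvd_power_same)
    qed
    \<comment> \<open>The columns of the sequences 1 and j give a constant and a linear factor.\<close>
    define a0 where "a0 k = (\<Sum>s<8. head_coeff k s + tail_coeff k s :: complex)" for k
    define a1 where "a1 k = (\<Sum>s<8. (head_coeff k s + tail_coeff k s) * of_nat s :: complex)" for k
    define b1 where "b1 k = (\<Sum>s<8. tail_coeff k s :: complex)" for k
    define f where "f k c = (\<Sum>s<8. head_coeff k s * z c ^ s)" for k c
    define g where "g k c = (\<Sum>s<8. tail_coeff k s * z c ^ s)" for k c
    let ?P = "{p. p permutes {0..<8 :: nat}}"
    have h: "h = (\<lambda>m. \<Sum>p\<in>?P. (8 * signof p * a0 (p 0) / det ?V) *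
      ((of_int m + 9) * (a1 (p 1) + of_int m * b1 (p 1)) * (- 1) powi m *
       (\<Prod>c\<in>{2..<8}. f (p c) c + z c powi m * g (p c) c)))"
    proof
      fix m
      let ?A = "boundary_int_mat z m"
      have A0: "?A $$ (k, 0) = a0 k" if "k < 8" for k
        using that by (simp add: boundary_int_mat_def basis_def a0_def)
      have A1: "?A $$ (k, 1) = a1 k + of_int m * b1 k" if "k < 8" for k
        using that by (simp add: boundary_int_mat_def basis_def a1_def b1_def sum_distrib_left
          sum.distrib[symmetric] algebra_simps)
      have Ac: "?A $$ (k, c) = f k c + z c powi m * g k c" if "k < 8" "c \<in> {2..<8}" for k c
        using that z0[OF that(2)] by (simp add: boundary_int_mat_def basis_def f_def g_def sum_distrib_left
          sum.distrib power_int_add mult_ac)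
      have "det ?A = (\<Sum>p\<in>?P. signof p * (\<Prod>j<8. ?A $$ (p j, j)))"
        by (rule det_col) (simp add: boundary_int_mat_def)
      also have "\<dots> = (\<Sum>p\<in>?P. signof p * (a0 (p 0) * ((a1 (p 1) + of_int m * b1 (p 1)) *
          (\<Prod>c\<in>{2..<8}. f (p c) c + z c powi m * g (p c) c))))"
      proof (rule sum.cong)
        fix p assume "p \<in> ?P"
        then have p: "p j < 8" if "j < 8" for j
          using permutes_in_image[of p "{0..<8}" j] that by simp
        have "{..<8 :: nat} = insert 0 (insert 1 {2..<8})" by auto
        then have "(\<Prod>j<8. ?A $$ (p j, j)) = ?A $$ (p 0, 0) * (?A $$ (p 1, 1) * (\<Prod>c\<in>{2..<8}. ?A $$ (p c, c)))"
          by simp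
        also have "(\<Prod>c\<in>{2..<8}. ?A $$ (p c, c)) = (\<Prod>c\<in>{2..<8}. f (p c) c + z c powi m * g (p c) c)"
          using p by (intro prod.cong) (auto simp: Ac)
        finally show "signof p * (\<Prod>j<8. ?A $$ (p j, j)) = signof p * (a0 (p 0) * ((a1 (p 1) + of_int m * b1 (p 1)) *
          (\<Prod>c\<in>{2..<8}. f (p c) c + z c powi m * g (p c) c)))"
          using p by (simp add: A0 A1[simplified])
      qed simp
      finally have det_A: "det ?A = \<dots>" .
      show "h m = (\<Sum>p\<in>?P. (8 * signof p * a0 (p 0) / det ?V) *
        ((of_int m + 9) * (a1 (p 1) + of_int m * b1 (p 1)) * (- 1) powi m *
        (\<Prod>c\<in>{2..<8}. f (p c) c + z c powi m * g (p c) c)))"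
        unfolding h_def det_A sum_distrib_left sum_divide_distrib
        by (intro sum.cong refl) (simp only: times_divide_eq_left times_divide_eq_right mult_ac)
    qed
    have "shift_op (base_poly ^ 3) (\<lambda>m. (of_int m + 9) * (a1 (p 1) + of_int m * b1 (p 1)) * (- 1) powi m *
       (\<Prod>c\<in>{2..<8}. f (p c) c + z c powi m * g (p c) c)) n = 0" for p
      using z0 dvd by (intro shift_op_exponential_product) auto
    then show ?thesis
      unfolding h shift_op_sum shift_op_scale by simp
  qed
  ultimately show ?thesis by blast
qed

theorem theorem5p2p3:
  shows "\<exists>A4 :: rat poly. degree A4 = 80 \<and>
    Abs_fps (\<lambda>m. of_nat (ug_total_leaves (ug_power (cycle_ugraph (m + 9)) 4))) =
      fps_of_poly A4 / fps_of_poly B4"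
proof -
  define L :: "nat \<Rightarrow> rat" where "L m = of_nat (ug_total_leaves (ug_power (cycle_ugraph (m + 9)) 4))" for m
  obtain h :: "int \<Rightarrow> complex" where hL: "\<And>m. h (int m) = of_rat (L m)" and h1: "h (- 1) \<noteq> 0"
    and rec: "\<And>n. shift_op (base_poly ^ 3) h n = 0"
    using exists_leaf_recurrence unfolding L_def of_rat_of_nat_eq by blast
  have rec': "(\<Sum>i\<le>81. of_rat (coeff B4 i) * h (n - int i)) = 0" for n
  proof -
    have "degree (base_poly ^ 3) = 81" "\<And>i. coeff (base_poly ^ 3) i = of_rat (coeff B4 i)"
      unfolding map_poly_B4[symmetric] by (simp_all add: B4_monic)
    then show ?thesis using rec[of n] by (simp add: shift_op_def)
  qed
  define a where "a m = (\<Sum>i\<le>m. coeff B4 i * L (m - i))" for m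
  have a_h: "of_rat (a m) = (\<Sum>i\<le>m. of_rat (coeff B4 i) * h (int m - int i))" for m
    unfolding a_def of_rat_sum of_rat_mult
    by (intro sum.cong) (auto simp: hL[symmetric] of_nat_diff)
  have a_0: "a m = 0" if "80 < m" for m
  proof -
    have "(of_rat (a m) :: complex) = (\<Sum>i\<le>81. of_rat (coeff B4 i) * h (int m - int i))"
      unfolding a_h using that
      by (intro sum.mono_neutral_right) (auto simp: coeff_eq_0 B4_monic)
    then show ?thesis using rec' by simp
  qed
  \<comment> \<open>The recurrence at 80 involves one term more than the product, the one with the value at -1.\<close>
  have a_80: "a 80 \<noteq> 0"
  proof
    assume "a 80 = 0"
    have "(\<Sum>i\<le>81. of_rat (coeff B4 i) * h (80 - int i)) = of_rat (a 80) + of_rat (coeff B4 81) * h (- 1)"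
      unfolding a_h using sum.atMost_Suc[of "\<lambda>i. of_rat (coeff B4 i) * h (80 - int i)" 80] by simp
    with rec'[of 80] \<open>a 80 = 0\<close> h1 show False by (simp add: B4_monic)
  qed
  define A where "A = (\<Sum>m\<le>80. monom (a m) m)"
  have coeff_A: "coeff A m = a m" for m
    using a_0[of m] by (auto simp: A_def coeff_sum)
  have "degree A = 80"
    using a_80 by (intro antisym degree_le le_degree) (auto simp: coeff_A a_0)
  moreover have "fps_of_poly A = fps_of_poly B4 * Abs_fps L"
    by (rule fps_ext) (simp add: coeff_A fps_mult_nth a_def atLeast0AtMost)
  then have "Abs_fps L = fps_of_poly A / fps_of_poly B4"
    using B4_monic by (auto simp: nonzero_mult_div_cancel_left)
  ultimately show ?thesis
    unfolding L_def[abs_def] by blast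
qed

end
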